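(* Let $E$ be a Dedekind complete vector lattice, and let $\mathcal{A}$ be a (not necessarily unital) associative subalgebra of $\mathrm{Orth}(E)$. Then the adherences $a_{\mathrm{uo}}(\mathcal{A})$ and $a_{\mathrm{SUO}}(\mathcal{A})$ in $\mathcal{L}_{\mathrm{ob}}(E)$ are equal, and are subalgebras of $\mathrm{Orth}(E)$. When $\mathcal{A}$ is a vector lattice subalgebra of $\mathrm{Orth}(E)$ (i.e. a subalgebra that is also a vector sublattice), then so is $a_{\mathrm{uo}}(\mathcal{A})=a_{\mathrm{SUO}}(\mathcal{A})$.
   Context: All vector lattices are real and Archimedean. $\mathcal{L}_{\mathrm{ob}}(E)$ is the space of order bounded linear operators on $E$, a Dedekind complete vector lattice in the operator order when $E$ is Dedekind complete; $\mathrm{Orth}(E)$ is the vector lattice algebra of orthomorphisms on $E$, i.e. of order bounded linear operators $T:E\to E$ with $T(B)\subseteq B$ for every band $B$ of $E$. In a vector lattice $G$, a net $(x_\alpha)_{\alpha\in A}$ is order convergent to $x$ ($x_\alpha\xrightarrow{\mathrm{o}}x$) if there is a net $(y_\beta)_{\beta\in B}$ in $G$ with $y_\beta\downarrow 0$ such that for every $\beta_0\in B$ there is $\alpha_0\in A$ with $|x-x_\alpha|\le y_{\beta_0}$ for all $\alpha\ge\alpha_0$; it is unbounded order convergent to $x$ ($x_\alpha\xrightarrow{\mathrm{uo}}x$) if $|x_\alpha-x|\wedge y\xrightarrow{\mathrm{o}}0$ in $G$ for all $y\in G^+$. Strong unbounded order convergence $T_\alpha\xrightarrow{\mathrm{SUO}}T$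 in $\mathcal{L}_{\mathrm{ob}}(E)$ means $T_\alpha x\xrightarrow{\mathrm{uo}}Tx$ in $E$ for all $x\in E$. For $\mathcal{S}\subseteq\mathcal{L}_{\mathrm{ob}}(E)$, the adherence $a_{\mathrm{uo}}(\mathcal{S})$ (resp. $a_{\mathrm{SUO}}(\mathcal{S})$) in $\mathcal{L}_{\mathrm{ob}}(E)$ is the set of all $T\in\mathcal{L}_{\mathrm{ob}}(E)$ for which there is a net in $\mathcal{S}$ that is unbounded order convergent to $T$ in $\mathcal{L}_{\mathrm{ob}}(E)$ (resp. strongly unbounded order convergent to $T$). *)

theory Defs
  imports Complex_Main "HOL-Library.Lattice_Algebras"
begin

section \<open>Vector lattices\<close>

class vector_lattice = ordered_real_vector + lattice_ab_group_add_abs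

text \<open>The class of conditionally complete lattices requires suprema and infima only for nonempty
  sets bounded above resp. below, so its conjunction with the previous class is Dedekind
  completeness. Dedekind complete vector lattices are automatically Archimedean.\<close>

class dedekind_complete_vector_lattice = vector_lattice + conditionally_complete_lattice

definition is_supremum :: "'a::order set \<Rightarrow> 'a \<Rightarrow> bool" where
  "is_supremum D s \<longleftrightarrow> (\<forall>x\<in>D. x \<le> s) \<and> (\<forall>u. (\<forall>x\<in>D. x \<le> u) \<longrightarrow> s \<le> u)"

definition is_infimum :: "'a::order set \<Rightarrow> 'a \<Rightarrow> bool" where
  "is_infimum D s \<longleftrightarrow> (\<forall>x\<in>D. s \<le> x) \<and> (\<forall>u. (\<forall>x\<in>D. u \<le> x) \<longrightarrow> u \<le> s)"

definition order_ideal :: "'a::vector_lattice set \<Rightarrow> bool" where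
  "order_ideal B \<longleftrightarrow> subspace B \<and> (\<forall>x y. y \<in> B \<and> \<bar>x\<bar> \<le> \<bar>y\<bar> \<longrightarrow> x \<in> B)"

definition band :: "'a::vector_lattice set \<Rightarrow> bool" where
  "band B \<longleftrightarrow> order_ideal B \<and> (\<forall>D s. D \<subseteq> B \<and> is_supremum D s \<longrightarrow> s \<in> B)"

definition vector_sublattice :: "'a::vector_lattice set \<Rightarrow> bool" where
  "vector_sublattice S \<longleftrightarrow>
     subspace S \<and> (\<forall>x\<in>S. \<forall>y\<in>S. sup x y \<in> S \<and> inf x y \<in> S)"

section \<open>Nets, order convergence and unbounded order convergence\<close>

definition directed_set :: "'i set \<Rightarrow> ('i \<Rightarrow> 'i \<Rightarrow> bool) \<Rightarrow> bool" where
  "directed_set I le \<longleftrightarrow> I \<noteq> {} \<and> (\<forall>i\<in>I. le i i) \<and>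
     (\<forall>i\<in>I. \<forall>j\<in>I. \<forall>k\<in>I. le i j \<and> le j k \<longrightarrow> le i k) \<and>
     (\<forall>i\<in>I. \<forall>j\<in>I. \<exists>k\<in>I. le i k \<and> le j k)"

definition decreases_to_zero ::
  "'j set \<Rightarrow> ('j \<Rightarrow> 'j \<Rightarrow> bool) \<Rightarrow> ('j \<Rightarrow> 'a::vector_lattice) \<Rightarrow> bool" where
  "decreases_to_zero J le y \<longleftrightarrow> directed_set J le \<and>
     (\<forall>i\<in>J. \<forall>j\<in>J. le i j \<longrightarrow> y j \<le> y i) \<and> is_infimum (y ` J) 0"

text \<open>HOL cannot quantify existentially over types, so the index set of the dominating net is taken
  inside the type of the vector lattice itself. This is no restriction: a decreasing net
  can be reindexed by its range, see \<open>order_converges_any_index\<close>.\<close>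

definition order_converges ::
  "'i set \<Rightarrow> ('i \<Rightarrow> 'i \<Rightarrow> bool) \<Rightarrow> ('i \<Rightarrow> 'a::vector_lattice) \<Rightarrow> 'a \<Rightarrow> bool" where
  "order_converges I le x l \<longleftrightarrow>
     (\<exists>(J :: 'a set) le' y. decreases_to_zero J le' y \<and>
        (\<forall>j\<in>J. \<exists>i0\<in>I. \<forall>i\<in>I. le i0 i \<longrightarrow> \<bar>l - x i\<bar> \<le> y j))"

definition uo_converges ::
  "'i set \<Rightarrow> ('i \<Rightarrow> 'i \<Rightarrow> bool) \<Rightarrow> ('i \<Rightarrow> 'a::vector_lattice) \<Rightarrow> 'a \<Rightarrow> bool" where
  "uo_converges I le x l \<longleftrightarrow>
     (\<forall>y\<ge>0. order_converges I le (\<lambda>i. inf \<bar>x i - l\<bar> y) 0)"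

lemma order_converges_any_index:
  fixes x :: "'i \<Rightarrow> 'a::vector_lattice" and y :: "'j \<Rightarrow> 'a"
  assumes y: "decreases_to_zero J le' y"
    and dom: "\<forall>j\<in>J. \<exists>i0\<in>I. \<forall>i\<in>I. le i0 i \<longrightarrow> \<bar>l - x i\<bar> \<le> y j"
  shows "order_converges I le x l"
proof -
  have dec: "y j \<le> y i" if "i \<in> J" "j \<in> J" "le' i j" for i j
    using y that unfolding decreases_to_zero_def by blast
  have dir: "J \<noteq> {}" "\<And>i j. i \<in> J \<Longrightarrow> j \<in> J \<Longrightarrow> \<exists>k\<in>J. le' i k \<and> le' j k"
    using y unfolding decreases_to_zero_def directed_set_def by blast+
  have "\<exists>k\<in>J. y k \<le> y i \<and> y k \<le> y j" if "i \<in> J" "j \<in> J" for i j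
    using dir(2)[OF that] dec that by blast
  then have "directed_set (y ` J) (\<lambda>u v. v \<le> u)"
    using dir(1) unfolding directed_set_def by (simp, blast intro: order_trans)
  moreover have "is_infimum (y ` J) 0"
    using y unfolding decreases_to_zero_def by blast
  ultimately have "decreases_to_zero (y ` J) (\<lambda>u v. v \<le> u) (\<lambda>u. u)"
    unfolding decreases_to_zero_def by simp
  moreover have "\<forall>u\<in>y ` J. \<exists>i0\<in>I. \<forall>i\<in>I. le i0 i \<longrightarrow> \<bar>l - x i\<bar> \<le> u"
    using dom by blast
  ultimately show ?thesis
    unfolding order_converges_def by blast
qed

section \<open>Order bounded operators\<close>

definition order_bounded_op :: "('a::vector_lattice \<Rightarrow> 'a) \<Rightarrow> bool" where
  "order_bounded_op T \<longleftrightarrow> (\<forall>a b. \<exists>c d. T ` {a..b} \<subseteq> {c..d})"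

lemma order_bounded_opI:
  assumes "\<And>a b. \<exists>c d. \<forall>x. a \<le> x \<and> x \<le> b \<longrightarrow> c \<le> T x \<and> T x \<le> d"
  shows "order_bounded_op T"
  unfolding order_bounded_op_def
proof (intro allI)
  fix a b
  obtain c d where "\<forall>x. a \<le> x \<and> x \<le> b \<longrightarrow> c \<le> T x \<and> T x \<le> d" using assms by blast
  then have "T ` {a..b} \<subseteq> {c..d}" by auto
  then show "\<exists>c d. T ` {a..b} \<subseteq> {c..d}" by blast
qed

lemma order_bounded_opE:
  assumes "order_bounded_op T"
  obtains c d where "\<And>x. a \<le> x \<Longrightarrow> x \<le> b \<Longrightarrow> c \<le> T x \<and> T x \<le> d"
proof -
  obtain c d where "T ` {a..b} \<subseteq> {c..d}" using assms unfolding order_bounded_op_def by blast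
  then have "\<And>x. a \<le> x \<Longrightarrow> x \<le> b \<Longrightarrow> c \<le> T x \<and> T x \<le> d" by (auto simp: image_subset_iff)
  then show thesis using that by blast
qed

lemma order_bounded_op_zero: "order_bounded_op (\<lambda>x. 0)"
  by (rule order_bounded_opI) blast

lemma order_bounded_op_add:
  assumes "order_bounded_op S" "order_bounded_op T"
  shows "order_bounded_op (\<lambda>x. S x + T x)"
proof (rule order_bounded_opI)
  fix a b
  obtain c d where 1: "\<And>x. a \<le> x \<Longrightarrow> x \<le> b \<Longrightarrow> c \<le> S x \<and> S x \<le> d"
    using order_bounded_opE[OF assms(1)] by blast
  obtain c' d' where 2: "\<And>x. a \<le> x \<Longrightarrow> x \<le> b \<Longrightarrow> c' \<le> T x \<and> T x \<le> d'"
    using order_bounded_opE[OF assms(2)] by blast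
  have "\<forall>x. a \<le> x \<and> x \<le> b \<longrightarrow> c + c' \<le> S x + T x \<and> S x + T x \<le> d + d'"
    using 1 2 by (simp add: add_mono)
  then show "\<exists>c d. \<forall>x. a \<le> x \<and> x \<le> b \<longrightarrow> c \<le> S x + T x \<and> S x + T x \<le> d" by blast
qed

lemma order_bounded_op_uminus:
  assumes "order_bounded_op T"
  shows "order_bounded_op (\<lambda>x. - T x)"
proof (rule order_bounded_opI)
  fix a b
  obtain c d where 1: "\<And>x. a \<le> x \<Longrightarrow> x \<le> b \<Longrightarrow> c \<le> T x \<and> T x \<le> d"
    using order_bounded_opE[OF assms(1)] by blast
  have "\<forall>x. a \<le> x \<and> x \<le> b \<longrightarrow> - d \<le> - T x \<and> - T x \<le> - c"
    using 1 by simp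
  then show "\<exists>c d. \<forall>x. a \<le> x \<and> x \<le> b \<longrightarrow> c \<le> - T x \<and> - T x \<le> d" by blast
qed

lemma order_bounded_op_scaleR:
  assumes "order_bounded_op T"
  shows "order_bounded_op (\<lambda>x. r *\<^sub>R T x)"
proof -
  have pos: "order_bounded_op (\<lambda>x. r *\<^sub>R T x)" if "0 \<le> r" for r
  proof (rule order_bounded_opI)
    fix a b
    obtain c d where 1: "\<And>x. a \<le> x \<Longrightarrow> x \<le> b \<Longrightarrow> c \<le> T x \<and> T x \<le> d"
      using order_bounded_opE[OF assms(1)] by blast
    have "\<forall>x. a \<le> x \<and> x \<le> b \<longrightarrow> r *\<^sub>R c \<le> r *\<^sub>R T x \<and> r *\<^sub>R T x \<le> r *\<^sub>R d"
      using 1 that by (simp add: scaleR_left_mono)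
    then show "\<exists>c d. \<forall>x. a \<le> x \<and> x \<le> b \<longrightarrow> c \<le> r *\<^sub>R T x \<and> r *\<^sub>R T x \<le> d" by blast
  qed
  show ?thesis
  proof (cases "0 \<le> r")
    case True then show ?thesis by (rule pos)
  next
    case False
    then show ?thesis using order_bounded_op_uminus[OF pos[of "- r"]] by simp
  qed
qed

lemma order_bounded_op_comp:
  assumes "order_bounded_op S" "order_bounded_op T"
  shows "order_bounded_op (\<lambda>x. S (T x))"
proof (rule order_bounded_opI)
  fix a b
  obtain c d where 1: "\<And>x. a \<le> x \<Longrightarrow> x \<le> b \<Longrightarrow> c \<le> T x \<and> T x \<le> d"
    using order_bounded_opE[OF assms(2)] by blast
  obtain c' d' where 2: "\<And>x. c \<le> x \<Longrightarrow> x \<le> d \<Longrightarrow> c' \<le> S x \<and> S x \<le> d'"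
    using order_bounded_opE[OF assms(1)] by blast
  show "\<exists>c d. \<forall>x. a \<le> x \<and> x \<le> b \<longrightarrow> c \<le> S (T x) \<and> S (T x) \<le> d" using 1 2 by blast
qed

typedef (overloaded) 'a ob_op =
  "{T :: 'a::vector_lattice \<Rightarrow> 'a. linear T \<and> order_bounded_op T}"
  morphisms ob_apply Abs_ob_op
  by (rule exI[of _ "\<lambda>x. 0"]) (simp add: order_bounded_op_zero module_hom_zero)

setup_lifting type_definition_ob_op

lemma linear_ob_apply: "linear (ob_apply T)"
  using ob_apply[of T] by simp

lemma order_bounded_ob_apply: "order_bounded_op (ob_apply T)"
  using ob_apply[of T] by simp

text \<open>Multiplication is composition; since the identity need not differ from zero, the class
  of unital real algebras is not available.\<close>

instantiation ob_op :: (vector_lattice) real_algebra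
begin

lift_definition zero_ob_op :: "'a ob_op" is "\<lambda>x. 0"
  by (simp add: order_bounded_op_zero module_hom_zero)

lift_definition plus_ob_op :: "'a ob_op \<Rightarrow> 'a ob_op \<Rightarrow> 'a ob_op" is "\<lambda>S T x. S x + T x"
  by (simp add: order_bounded_op_add linear_compose_add)

lift_definition uminus_ob_op :: "'a ob_op \<Rightarrow> 'a ob_op" is "\<lambda>T x. - T x"
  by (simp add: order_bounded_op_uminus linear_compose_neg)

lift_definition minus_ob_op :: "'a ob_op \<Rightarrow> 'a ob_op \<Rightarrow> 'a ob_op" is "\<lambda>S T x. S x - T x"
  using order_bounded_op_add[OF _ order_bounded_op_uminus]
  by (fastforce simp: linear_compose_sub)

lift_definition scaleR_ob_op :: "real \<Rightarrow> 'a ob_op \<Rightarrow> 'a ob_op" is "\<lambda>r T x. r *\<^sub>R T x"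
  by (simp add: order_bounded_op_scaleR linear_compose_scale_right)

lift_definition times_ob_op :: "'a ob_op \<Rightarrow> 'a ob_op \<Rightarrow> 'a ob_op" is "\<lambda>S T x. S (T x)"
  using linear_compose by (fastforce simp: order_bounded_op_comp o_def)

instance
  by standard
    (transfer; simp add: fun_eq_iff algebra_simps linear_add linear_scale)+

end

instantiation ob_op :: (vector_lattice) ordered_real_vector
begin

lift_definition less_eq_ob_op :: "'a ob_op \<Rightarrow> 'a ob_op \<Rightarrow> bool" is
  "\<lambda>S T. \<forall>x\<ge>0. S x \<le> T x" .

definition less_ob_op :: "'a ob_op \<Rightarrow> 'a ob_op \<Rightarrow> bool" where
  "less_ob_op S T \<longleftrightarrow> S \<le> T \<and> \<not> T \<le> S"

instance
proof
  fix S T :: "'a ob_op"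
  assume "S \<le> T" "T \<le> S"
  then show "S = T"
  proof (transfer)
    fix S T :: "'a \<Rightarrow> 'a"
    assume S: "linear S \<and> order_bounded_op S" and T: "linear T \<and> order_bounded_op T"
      and 1: "\<forall>x\<ge>0. S x \<le> T x" and 2: "\<forall>x\<ge>0. T x \<le> S x"
    have eq: "S x = T x" if "0 \<le> x" for x using 1 2 that by (simp add: antisym)
    show "S = T"
    proof
      fix x :: 'a
      have x: "x = pprt x - (- nprt x)" using prts[of x] by simp
      have "S x = S (pprt x) - S (- nprt x)" by (subst x, rule linear_diff) (use S in simp)
      also have "\<dots> = T (pprt x) - T (- nprt x)" by (simp add: eq)
      also have "\<dots> = T x" by (subst (3) x, rule linear_diff[symmetric]) (use T in simp)
      finally show "S x = T x" .
    qed
  qed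
qed (transfer; auto simp: less_ob_op_def scaleR_left_mono scaleR_right_mono
       less_eq_ob_op.rep_eq intro: order_trans)+

end

lemma ob_apply_simps [simp]:
  "ob_apply 0 x = 0"
  "ob_apply (S + T) x = ob_apply S x + ob_apply T x"
  "ob_apply (S - T) x = ob_apply S x - ob_apply T x"
  "ob_apply (- T) x = - ob_apply T x"
  "ob_apply (r *\<^sub>R T) x = r *\<^sub>R ob_apply T x"
  "ob_apply (S * T) x = ob_apply S (ob_apply T x)"
  by (transfer; simp)+

subsection \<open>The lattice structure of the order bounded operators\<close>

text \<open>The Riesz--Kantorovich formula for the positive part.\<close>

definition rk_pos :: "('a::dedekind_complete_vector_lattice \<Rightarrow> 'a) \<Rightarrow> 'a \<Rightarrow> 'a" where
  "rk_pos T x = Sup (T ` {0..x})"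

context
  fixes T :: "'a::dedekind_complete_vector_lattice \<Rightarrow> 'a"
  assumes lin: "linear T" and ob: "order_bounded_op T"
begin

lemma rk_bdd: "bdd_above (T ` {0..x})"
proof -
  obtain c d where "\<And>y. 0 \<le> y \<Longrightarrow> y \<le> x \<Longrightarrow> c \<le> T y \<and> T y \<le> d"
    using order_bounded_opE[OF ob] by blast
  then show ?thesis by (intro bdd_aboveI[of _ d]) auto
qed

lemma rk_upper: "0 \<le> y \<Longrightarrow> y \<le> x \<Longrightarrow> T y \<le> rk_pos T x"
  unfolding rk_pos_def by (rule cSup_upper) (auto simp: rk_bdd)

lemma rk_least: "0 \<le> x \<Longrightarrow> (\<And>y. 0 \<le> y \<Longrightarrow> y \<le> x \<Longrightarrow> T y \<le> u) \<Longrightarrow> rk_pos T x \<le> u"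
  unfolding rk_pos_def by (rule cSup_least) auto

lemma rk_nonneg: "0 \<le> x \<Longrightarrow> 0 \<le> rk_pos T x"
  using rk_upper[of 0 x] linear_0[OF lin] by simp

lemma rk_add:
  assumes x: "0 \<le> x" and y: "0 \<le> y"
  shows "rk_pos T (x + y) = rk_pos T x + rk_pos T y"
proof (rule antisym)
  show "rk_pos T (x + y) \<le> rk_pos T x + rk_pos T y"
  proof (rule rk_least)
    fix u assume u: "0 \<le> u" "u \<le> x + y"
    have "u - inf u x = sup 0 (u - x)"
      by (simp add: add_sup_distrib_left)
    also have "\<dots> \<le> y" using u y by (simp add: diff_le_eq add.commute)
    finally have 1: "u - inf u x \<le> y" .
    have "T u = T (inf u x) + T (u - inf u x)"
      by (simp only: linear_diff[OF lin]) simp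
    also have "\<dots> \<le> rk_pos T x + rk_pos T y"
      by (intro add_mono rk_upper 1) (use u x in \<open>simp_all only: le_diff_eq add_0 inf_le1 inf_le2 le_infI\<close>)
    finally show "T u \<le> rk_pos T x + rk_pos T y" .
  qed (use x y in simp)
next
  have "rk_pos T x \<le> rk_pos T (x + y) - rk_pos T y"
  proof (rule rk_least[OF x])
    fix u assume u: "0 \<le> u" "u \<le> x"
    have "rk_pos T y \<le> rk_pos T (x + y) - T u"
    proof (rule rk_least[OF y])
      fix v assume v: "0 \<le> v" "v \<le> y"
      have "T (u + v) \<le> rk_pos T (x + y)"
        by (rule rk_upper) (use u v in \<open>auto intro: add_mono\<close>)
      then show "T v \<le> rk_pos T (x + y) - T u"
        by (simp add: linear_add[OF lin] le_diff_eq add.commute)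
    qed
    then show "T u \<le> rk_pos T (x + y) - rk_pos T y" by (simp add: le_diff_eq add.commute)
  qed
  then show "rk_pos T x + rk_pos T y \<le> rk_pos T (x + y)" by (simp add: le_diff_eq)
qed

lemma rk_scale_le:
  assumes r: "0 < r" and x: "0 \<le> x"
  shows "rk_pos T (r *\<^sub>R x) \<le> r *\<^sub>R rk_pos T x"
proof (rule rk_least)
  show "0 \<le> r *\<^sub>R x" using r x scaleR_left_mono[of 0 x r] by simp
  fix u assume u: "0 \<le> u" "u \<le> r *\<^sub>R x"
  have a: "0 \<le> inverse r *\<^sub>R u" using r u scaleR_left_mono[of 0 u "inverse r"] by simp
  have b: "inverse r *\<^sub>R u \<le> x" using r u scaleR_left_mono[of u "r *\<^sub>R x" "inverse r"] by simp
  have "T u = r *\<^sub>R T (inverse r *\<^sub>R u)" using r by (simp add: linear_scale[OF lin])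
  also have "\<dots> \<le> r *\<^sub>R rk_pos T x"
    using rk_upper[OF a b] r by (simp add: scaleR_left_mono)
  finally show "T u \<le> r *\<^sub>R rk_pos T x" .
qed

lemma rk_scale:
  assumes r: "0 \<le> r" and x: "0 \<le> x"
  shows "rk_pos T (r *\<^sub>R x) = r *\<^sub>R rk_pos T x"
proof (cases "r = 0")
  case True
  have "rk_pos T 0 = rk_pos T 0 + rk_pos T 0" using rk_add[of 0 0] by simp
  then show ?thesis using True by simp
next
  case False
  with r have r: "0 < r" by simp
  have rx: "0 \<le> r *\<^sub>R x" using r x scaleR_left_mono[of 0 x r] by simp
  have "rk_pos T x \<le> inverse r *\<^sub>R rk_pos T (r *\<^sub>R x)"
    using rk_scale_le[of "inverse r" "r *\<^sub>R x"] r rx by simp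
  then have "r *\<^sub>R rk_pos T x \<le> rk_pos T (r *\<^sub>R x)"
    using r scaleR_left_mono[of "rk_pos T x" "inverse r *\<^sub>R rk_pos T (r *\<^sub>R x)" r] by simp
  with rk_scale_le[OF r x] show ?thesis by (rule antisym)
qed

definition rk_ext :: "'a \<Rightarrow> 'a" where
  "rk_ext x = rk_pos T (pprt x) - rk_pos T (- nprt x)"

lemma rk_ext_diff:
  assumes "0 \<le> a" "0 \<le> b"
  shows "rk_ext (a - b) = rk_pos T a - rk_pos T b"
proof -
  let ?x = "a - b"
  have "pprt ?x + b = - nprt ?x + a" using prts[of ?x] by (simp add: algebra_simps)
  then have "rk_pos T (pprt ?x) + rk_pos T b = rk_pos T (- nprt ?x) + rk_pos T a"
    using assms rk_add[of "pprt ?x" b] rk_add[of "- nprt ?x" a] by simp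
  then show ?thesis unfolding rk_ext_def by (simp add: algebra_simps)
qed

lemma rk_ext_pos: "0 \<le> x \<Longrightarrow> rk_ext x = rk_pos T x"
  using rk_ext_diff[of x 0] rk_scale[of 0 0] by simp

lemma linear_rk_ext: "linear rk_ext"
proof
  fix x y :: 'a
  have x: "x = pprt x - (- nprt x)" and y: "y = pprt y - (- nprt y)"
    using prts[of x] prts[of y] by simp_all
  have "x + y = (pprt x - (- nprt x)) + (pprt y - (- nprt y))"
    using x y by (rule arg_cong2)
  also have "\<dots> = (pprt x + pprt y) - ((- nprt x) + (- nprt y))"
    by (simp add: algebra_simps)
  finally have "rk_ext (x + y) = rk_pos T (pprt x + pprt y) - rk_pos T ((- nprt x) + (- nprt y))"
    by (metis rk_ext_diff add_nonneg_nonneg zero_le_pprt neg_0_le_iff_le nprt_le_zero)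
  then show "rk_ext (x + y) = rk_ext x + rk_ext y"
    using rk_add[of "pprt x" "pprt y"] rk_add[of "- nprt x" "- nprt y"]
    unfolding rk_ext_def by (simp add: algebra_simps)
next
  fix r :: real and x :: 'a
  have nn: "0 \<le> s *\<^sub>R z" if "0 \<le> s" "0 \<le> z" for s :: real and z :: 'a
    using that scaleR_left_mono[of 0 z s] by simp
  have x: "x = pprt x - (- nprt x)" using prts[of x] by simp
  show "rk_ext (r *\<^sub>R x) = r *\<^sub>R rk_ext x"
  proof (cases "0 \<le> r")
    case True
    have "r *\<^sub>R x = r *\<^sub>R pprt x - r *\<^sub>R (- nprt x)"
      by (subst x) (simp only: scaleR_diff_right)
    then have "rk_ext (r *\<^sub>R x) = rk_pos T (r *\<^sub>R pprt x) - rk_pos T (r *\<^sub>R (- nprt x))"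
      using True by (simp only: rk_ext_diff nn zero_le_pprt neg_0_le_iff_le nprt_le_zero)
    also have "\<dots> = r *\<^sub>R rk_pos T (pprt x) - r *\<^sub>R rk_pos T (- nprt x)"
      using True by (simp only: rk_scale zero_le_pprt neg_0_le_iff_le nprt_le_zero)
    finally show ?thesis unfolding rk_ext_def by (simp only: scaleR_diff_right)
  next
    case False
    define s where "s = - r"
    have s: "0 \<le> s" using False s_def by simp
    have "r *\<^sub>R x = s *\<^sub>R (- nprt x) - s *\<^sub>R pprt x"
      using arg_cong[OF prts[of x], of "(*\<^sub>R) r"]
      by (simp add: s_def scaleR_right_distrib)
    then have "rk_ext (r *\<^sub>R x) = rk_pos T (s *\<^sub>R (- nprt x)) - rk_pos T (s *\<^sub>R pprt x)"
      using s by (simp only: rk_ext_diff nn zero_le_pprt neg_0_le_iff_le nprt_le_zero)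
    also have "\<dots> = s *\<^sub>R rk_pos T (- nprt x) - s *\<^sub>R rk_pos T (pprt x)"
      using s by (simp only: rk_scale zero_le_pprt neg_0_le_iff_le nprt_le_zero)
    finally show ?thesis unfolding rk_ext_def s_def by (simp add: scaleR_diff_right)
  qed
qed

lemma order_bounded_rk_ext: "order_bounded_op rk_ext"
proof (rule order_bounded_opI)
  fix a b :: 'a
  have mono: "rk_ext x \<le> rk_ext y" if "x \<le> y" for x y
  proof -
    have "0 \<le> rk_ext (y - x)" using that by (simp add: rk_ext_pos rk_nonneg)
    then show ?thesis by (simp add: linear_diff[OF linear_rk_ext])
  qed
  show "\<exists>c d. \<forall>x. a \<le> x \<and> x \<le> b \<longrightarrow> c \<le> rk_ext x \<and> rk_ext x \<le> d"
    using mono by blast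
qed

end

lift_definition ob_pos :: "'a::dedekind_complete_vector_lattice ob_op \<Rightarrow> 'a ob_op" is
  "rk_ext" by (simp add: linear_rk_ext order_bounded_rk_ext)

lemma ob_pos_apply: "0 \<le> x \<Longrightarrow> ob_apply (ob_pos T) x = Sup (ob_apply T ` {0..x})"
  by (transfer) (simp add: rk_ext_pos rk_pos_def)

lemma is_supremum_ob_pos: "is_supremum {T, 0} (ob_pos T)"
proof -
  have "T \<le> ob_pos T"
    by transfer (auto simp: rk_ext_pos intro: rk_upper)
  moreover have "0 \<le> ob_pos T"
    by transfer (auto simp: rk_ext_pos intro: rk_nonneg)
  moreover have "ob_pos T \<le> U" if "T \<le> U" "0 \<le> U" for U
    using that
  proof transfer
    fix T U :: "'a \<Rightarrow> 'a"
    assume T: "linear T \<and> order_bounded_op T" and U: "linear U \<and> order_bounded_op U"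
      and TU: "\<forall>x\<ge>0. T x \<le> U x" and U0: "\<forall>x\<ge>0. 0 \<le> U x"
    show "\<forall>x\<ge>0. rk_ext T x \<le> U x"
    proof (intro allI impI)
      fix x :: 'a assume x: "0 \<le> x"
      have "rk_pos T x \<le> U x"
      proof (rule rk_least)
        fix y assume y: "0 \<le> y" "y \<le> x"
        have "0 \<le> U (x - y)" using U0 y by simp
        then have "U y \<le> U x" using U by (simp add: linear_diff)
        then show "T y \<le> U x" using TU y by (meson order_trans)
      qed (use T x in auto)
      then show "rk_ext T x \<le> U x" using T x by (simp add: rk_ext_pos)
    qed
  qed
  ultimately show ?thesis unfolding is_supremum_def by simp
qed

instantiation ob_op :: (dedekind_complete_vector_lattice) vector_lattice
begin

definition sup_ob_op :: "'a ob_op \<Rightarrow> 'a ob_op \<Rightarrow> 'a ob_op" where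
  "sup_ob_op S T = S + ob_pos (T - S)"

definition inf_ob_op :: "'a ob_op \<Rightarrow> 'a ob_op \<Rightarrow> 'a ob_op" where
  "inf_ob_op S T = S - ob_pos (S - T)"

definition abs_ob_op :: "'a ob_op \<Rightarrow> 'a ob_op" where
  "abs_ob_op T = sup T (- T)"

instance
proof
  fix S T U :: "'a ob_op"
  have ge: "T - S \<le> ob_pos (T - S)" "0 \<le> ob_pos (T - S)" for S T :: "'a ob_op"
    using is_supremum_ob_pos[of "T - S"] unfolding is_supremum_def by auto
  have le: "ob_pos (T - S) \<le> U" if "T - S \<le> U" "0 \<le> U" for S T U :: "'a ob_op"
    using is_supremum_ob_pos[of "T - S"] that unfolding is_supremum_def by auto
  show "inf S T \<le> S" unfolding inf_ob_op_def using ge(2)[of S T] by simp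
  show "inf S T \<le> T" unfolding inf_ob_op_def using ge(1)[of S T] by (simp add: algebra_simps)
  show "S \<le> sup S T" unfolding sup_ob_op_def using ge(2)[of T S] by simp
  show "T \<le> sup S T" unfolding sup_ob_op_def using ge(1)[of T S] by (simp add: algebra_simps)
  show "\<bar>T\<bar> = sup T (- T)" by (rule abs_ob_op_def)
  show "S \<le> inf T U" if "S \<le> T" "S \<le> U"
    using le[of T U "T - S"] that unfolding inf_ob_op_def by (simp add: algebra_simps)
  show "sup T U \<le> S" if "T \<le> S" "U \<le> S"
    using le[of U T "S - T"] that unfolding sup_ob_op_def by (simp add: algebra_simps)
qed

end

section \<open>Orthomorphisms\<close>

definition Orth :: "'a::vector_lattice ob_op set" where
  "Orth = {T. \<forall>B. band B \<longrightarrow> ob_apply T ` B \<subseteq> B}"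

text \<open>Suprema and infima in the next definition are taken in the lattice of all order bounded
  operators. By the following lemma the set of orthomorphisms is a sublattice, so that these
  coincide with the lattice operations of the ordered space of orthomorphisms.\<close>

definition subalgebra_of_Orth :: "'a::vector_lattice ob_op set \<Rightarrow> bool" where
  "subalgebra_of_Orth A \<longleftrightarrow> A \<subseteq> Orth \<and> subspace A \<and> (\<forall>S\<in>A. \<forall>T\<in>A. S * T \<in> A)"

definition vector_lattice_subalgebra_of_Orth ::
  "'a::dedekind_complete_vector_lattice ob_op set \<Rightarrow> bool" where
  "vector_lattice_subalgebra_of_Orth A \<longleftrightarrow> subalgebra_of_Orth A \<and> vector_sublattice A"

lemma vector_lattice_subalgebra_Orth:
  "vector_lattice_subalgebra_of_Orth (Orth :: 'a::dedekind_complete_vector_lattice ob_op set)"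
proof -
  have subsp: "subspace (Orth :: 'a ob_op set)"
    unfolding subspace_def Orth_def band_def order_ideal_def by (auto simp: image_subset_iff)
  have mult: "S * T \<in> Orth" if "S \<in> Orth" "T \<in> Orth" for S T :: "'a ob_op"
    using that unfolding Orth_def by (auto simp: image_subset_iff)
  have pos: "ob_pos U \<in> Orth" if U: "U \<in> Orth" for U :: "'a ob_op"
    unfolding Orth_def
  proof (clarify)
    fix B :: "'a set" and x assume B: "band B" and x: "x \<in> B"
    have sub: "subspace B" and solid: "\<And>x y. y \<in> B \<Longrightarrow> \<bar>x\<bar> \<le> \<bar>y\<bar> \<Longrightarrow> x \<in> B"
      using B unfolding band_def order_ideal_def by auto
    have pos_in: "ob_apply (ob_pos U) y \<in> B" if y: "y \<in> B" "0 \<le> y" for y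
    proof -
      have "z \<in> B" if "z \<in> {0..y}" for z using solid[OF y(1), of z] that y(2) by simp
      then have "{0..y} \<subseteq> B" by blast
      moreover have "ob_apply U ` B \<subseteq> B" using U B unfolding Orth_def by blast
      ultimately have 1: "ob_apply U ` {0..y} \<subseteq> B" by blast
      have "is_supremum (ob_apply U ` {0..y}) (Sup (ob_apply U ` {0..y}))"
        unfolding is_supremum_def using y rk_bdd[OF linear_ob_apply order_bounded_ob_apply]
        by (auto intro!: cSup_upper cSup_least)
      then have "Sup (ob_apply U ` {0..y}) \<in> B" using 1 B unfolding band_def by blast
      then show ?thesis using y by (simp add: ob_pos_apply)
    qed
    have p: "pprt x \<in> B" and n: "- nprt x \<in> B"
      by (rule solid[OF x], simp add: abs_prts)+
    have "x = pprt x - (- nprt x)" using prts[of x] by simp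
    then have "ob_apply (ob_pos U) x =
        ob_apply (ob_pos U) (pprt x) - ob_apply (ob_pos U) (- nprt x)"
      by (metis linear_diff linear_ob_apply)
    then show "ob_apply (ob_pos U) x \<in> B"
      using pos_in[OF p] pos_in[OF n] sub by (simp add: subspace_diff)
  qed
  have "sup S T \<in> Orth \<and> inf S T \<in> Orth" if "S \<in> Orth" "T \<in> Orth" for S T :: "'a ob_op"
    unfolding sup_ob_op_def inf_ob_op_def
    using that subsp by (simp add: pos subspace_add subspace_diff)
  then show ?thesis
    unfolding vector_lattice_subalgebra_of_Orth_def subalgebra_of_Orth_def vector_sublattice_def
    using subsp mult by blast
qed

section \<open>Adherences in the order bounded operators\<close>

definition suo_converges ::
  "'i set \<Rightarrow> ('i \<Rightarrow> 'i \<Rightarrow> bool) \<Rightarrow> ('i \<Rightarrow> 'a::vector_lattice ob_op) \<Rightarrow> 'a ob_op \<Rightarrow> bool" where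
  "suo_converges I le T L \<longleftrightarrow>
     (\<forall>x. uo_converges I le (\<lambda>i. ob_apply (T i) x) (ob_apply L x))"

text \<open>As HOL cannot quantify existentially over types, index sets are subsets of a type that is
  large enough to reindex every net by pairs of a tail of the net and an element of
  this tail. The two lemmas at the end show that nets with any other index type give nothing
  more.\<close>

definition a_uo :: "'a::dedekind_complete_vector_lattice ob_op set \<Rightarrow> 'a ob_op set" where
  "a_uo S = {L. \<exists>(I :: ('a ob_op \<times> 'a ob_op set) set) le T.
     directed_set I le \<and> T ` I \<subseteq> S \<and> uo_converges I le T L}"

definition a_SUO :: "'a::dedekind_complete_vector_lattice ob_op set \<Rightarrow> 'a ob_op set" where
  "a_SUO S = {L. \<exists>(I :: ('a ob_op \<times> 'a ob_op set) set) le T.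
     directed_set I le \<and> T ` I \<subseteq> S \<and> suo_converges I le T L}"

definition tails :: "'i set \<Rightarrow> ('i \<Rightarrow> 'i \<Rightarrow> bool) \<Rightarrow> ('i \<Rightarrow> 'x) \<Rightarrow> ('x \<times> 'x set) set" where
  "tails I le T = (\<Union>i\<in>I. {(z, T ` {j\<in>I. le i j}) | z. z \<in> T ` {j\<in>I. le i j}})"

lemma directed_set_tails:
  assumes "directed_set I le"
  shows "directed_set (tails I le T) (\<lambda>p q. snd q \<subseteq> snd p)"
proof -
  have ne: "tails I le T \<noteq> {}"
    using assms unfolding directed_set_def tails_def by blast
  have "\<exists>r\<in>tails I le T. snd r \<subseteq> snd p \<and> snd r \<subseteq> snd q"
    if pq: "p \<in> tails I le T" "q \<in> tails I le T" for p q
  proof -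
    obtain i j where ij: "i \<in> I" "j \<in> I"
      and p: "snd p = T ` {k\<in>I. le i k}" and q: "snd q = T ` {k\<in>I. le j k}"
      using pq unfolding tails_def by auto
    obtain k where k: "k \<in> I" "le i k" "le j k"
      using assms ij unfolding directed_set_def by blast
    have tr: "le a c" if "a \<in> I" "b \<in> I" "c \<in> I" "le a b" "le b c" for a b c
      using assms that unfolding directed_set_def by blast
    have "le k k" using assms k unfolding directed_set_def by blast
    then have "(T k, T ` {l\<in>I. le k l}) \<in> tails I le T"
      using k unfolding tails_def by blast
    moreover have "T ` {l\<in>I. le k l} \<subseteq> snd p" "T ` {l\<in>I. le k l} \<subseteq> snd q"
      unfolding p q by (auto intro!: imageI intro: tr[OF _ k(1) _ k(2)] tr[OF _ k(1) _ k(3)] ij)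
    ultimately show ?thesis by (intro bexI[of _ "(T k, T ` {l\<in>I. le k l})"]) simp_all
  qed
  with ne show ?thesis unfolding directed_set_def by auto
qed

lemma order_converges_tails:
  assumes dir: "directed_set I le" and conv: "order_converges I le (\<lambda>i. f (T i)) l"
  shows "order_converges (tails I le T) (\<lambda>p q. snd q \<subseteq> snd p) (\<lambda>p. f (fst p)) l"
proof -
  obtain J :: "'b set" and le' y where y: "decreases_to_zero J le' y"
    and dom: "\<And>j. j \<in> J \<Longrightarrow> \<exists>i0\<in>I. \<forall>i\<in>I. le i0 i \<longrightarrow> \<bar>l - f (T i)\<bar> \<le> y j"
    using conv unfolding order_converges_def by blast
  have "\<exists>p0\<in>tails I le T. \<forall>p\<in>tails I le T. snd p \<subseteq> snd p0 \<longrightarrow> \<bar>l - f (fst p)\<bar> \<le> y j"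
    if "j \<in> J" for j
  proof -
    obtain i0 where i0: "i0 \<in> I" "\<And>i. i \<in> I \<Longrightarrow> le i0 i \<Longrightarrow> \<bar>l - f (T i)\<bar> \<le> y j"
      using dom[OF \<open>j \<in> J\<close>] by blast
    have "le i0 i0" using dir i0 unfolding directed_set_def by blast
    then have "(T i0, T ` {i\<in>I. le i0 i}) \<in> tails I le T"
      using i0 unfolding tails_def by blast
    moreover have "\<bar>l - f (fst p)\<bar> \<le> y j"
      if "p \<in> tails I le T" "snd p \<subseteq> T ` {i\<in>I. le i0 i}" for p
    proof -
      have "fst p \<in> snd p" using that(1) unfolding tails_def by auto
      then show ?thesis using that(2) i0(2) by auto
    qed
    ultimately show ?thesis by (intro bexI[of _ "(T i0, T ` {i\<in>I. le i0 i})"]) simp_all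
  qed
  with y show ?thesis unfolding order_converges_def by blast
qed

lemma a_uo_any_index:
  fixes T :: "'i \<Rightarrow> 'a::dedekind_complete_vector_lattice ob_op"
  assumes dir: "directed_set I le" and S: "T ` I \<subseteq> S" and conv: "uo_converges I le T L"
  shows "L \<in> a_uo S"
proof -
  have "uo_converges (tails I le T) (\<lambda>p q. snd q \<subseteq> snd p) fst L"
    using conv order_converges_tails[OF dir, where f = "\<lambda>z. inf \<bar>z - L\<bar> y" for y]
    unfolding uo_converges_def by blast
  moreover have "fst ` tails I le T \<subseteq> S" using S unfolding tails_def by auto
  ultimately show ?thesis unfolding a_uo_def using directed_set_tails[OF dir] by blast
qed

lemma a_SUO_any_index:
  fixes T :: "'i \<Rightarrow> 'a::dedekind_complete_vector_lattice ob_op"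
  assumes dir: "directed_set I le" and S: "T ` I \<subseteq> S" and conv: "suo_converges I le T L"
  shows "L \<in> a_SUO S"
proof -
  have "suo_converges (tails I le T) (\<lambda>p q. snd q \<subseteq> snd p) fst L"
    using conv order_converges_tails[OF dir, where T = T and
        f = "\<lambda>z. inf \<bar>ob_apply z x - ob_apply L x\<bar> y" for x y]
    unfolding suo_converges_def uo_converges_def by blast
  moreover have "fst ` tails I le T \<subseteq> S" using S unfolding tails_def by auto
  ultimately show ?thesis unfolding a_SUO_def using directed_set_tails[OF dir] by blast
qed

end

theory Submission
  imports Defs
begin

text \<open>Orthomorphisms behave like multiplication operators by functions, and both kinds of convergence of
  orthomorphisms behave like convergence of the truncations \<open>min \<bar>a\<^sub>i - a\<bar> 1\<close> of these functions. The proof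
  makes this precise without representing anything by functions: a family \<open>A\<^sub>i\<close> of orthomorphisms
  is called null if \<open>\<bar>A\<^sub>i x\<bar> \<and> x\<close> converges in order to zero for every \<open>x \<ge> 0\<close> (\<open>orth_null\<close>), and every
  assertion is reduced to this notion.

  The basis is that lattice operations of orthomorphisms are computed pointwise on the positive
  cone (\<open>ob_apply_ob_pos_Orth\<close>). If \<open>A\<^sub>i\<close> converges to zero in the unbounded order sense, then testing against
  the identity operator shows that it is null; here order convergence in the space of operators
  has to imply pointwise order convergence (\<open>order_null_ob_apply\<close>). If \<open>A\<^sub>i\<close> is null, then
  \<open>\<bar>A\<^sub>i x\<bar> \<and> y\<close> tends to zero for every \<open>y \<ge> 0\<close>: the part of \<open>y\<close> in the band generated by \<open>x\<close> is
  approximated by the elements \<open>y \<and> n x\<close>, and the part disjoint from \<open>x\<close> is not met by \<open>A\<^sub>i x\<close>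
  (\<open>orth_null_imp_order_null\<close>). Finally, this strong convergence implies convergence in the space of
  operators, since every bound for \<open>\<bar>A\<^sub>i x\<bar> \<and> R x\<close> at one point \<open>x\<close> dominates the value at \<open>x\<close> of an
  operator that bounds \<open>\<bar>A\<^sub>i\<bar> \<and> R\<close> (\<open>orth_null_imp_uo_null\<close>).

  For the adherences one also needs that limits of orthomorphisms are orthomorphisms, which holds
  because bands contain their unbounded order limits (\<open>band_limit\<close>). Both adherences
  thus coincide with \<open>orth_adherence\<close>.

  Closure under addition, scalar multiplication and suprema follows from the pointwise estimates
  for these operations. For multiplication, iterated limits would not do, since an adherence need
  not be closed; multiplication has to be jointly continuous. This rests on the inequality
  \<open>\<bar>P Q x\<bar> \<and> x \<le> \<bar>P x\<bar> \<and> x + \<bar>Q x\<bar> \<and> x\<close> (\<open>Orth_mult_inf_le\<close>), applied to the decomposition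
  \<open>S T - L M = (S - L) (T - M) + L (T - M) + (S - L) M\<close>. The middle term is null because
  \<open>L A = (L / n) (n A)\<close>, where \<open>L x / n\<close> is arbitrarily small and \<open>n A\<close> is null for each \<open>n\<close>.\<close>

section \<open>Vector lattice inequalities\<close>

text \<open>These rules rewrite the negative of an infimum to a supremum of negatives, which hides the terms of
  the form \<open>a - a \<and> b\<close> that occur below.\<close>

declare neg_inf_eq_sup [simp del] neg_sup_eq_inf [simp del]
  diff_inf_eq_sup [simp del] diff_sup_eq_inf [simp del]

lemma inf_add_le:
  fixes a b y :: "'a::vector_lattice"
  assumes "0 \<le> a" "0 \<le> b" "0 \<le> y"
  shows "inf (a + b) y \<le> inf a y + inf b y"
proof -
  have "inf a y + inf b y = inf (inf (a + b) (y + b)) (inf (a + y) (y + y))"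
    by (simp only: add_inf_distrib_left add_inf_distrib_right)
  moreover have "y \<le> y + b" "y \<le> a + y" "y \<le> y + y" using assms by simp_all
  ultimately show ?thesis by (simp only: le_inf_iff inf_le1) (meson inf_le2 order_trans)
qed

text \<open>By this estimate, a net that converges to \<open>l\<close> in the unbounded order sense has truncations
  \<open>\<bar>a\<bar> \<and> \<bar>l\<bar>\<close> that converge to \<open>\<bar>l\<bar>\<close> in order.\<close>

lemma abs_minus_inf_le:
  fixes a l :: "'a::vector_lattice"
  shows "\<bar>l\<bar> - inf \<bar>a\<bar> \<bar>l\<bar> \<le> inf \<bar>a - l\<bar> \<bar>l\<bar>"
proof -
  have "\<bar>l\<bar> - inf \<bar>a\<bar> \<bar>l\<bar> = sup (\<bar>l\<bar> - \<bar>a\<bar>) 0"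
    by (simp add: diff_inf_eq_sup add_sup_distrib_left)
  moreover have "\<bar>l\<bar> - \<bar>a\<bar> \<le> \<bar>a - l\<bar>"
    using abs_triangle_ineq2[of l a] by (simp add: abs_minus_commute)
  moreover have "\<bar>l\<bar> - \<bar>a\<bar> \<le> \<bar>l\<bar>" by simp
  ultimately show ?thesis by simp
qed

lemma inf_pprt_nprt: "inf (pprt c) (- nprt c) = (0 :: 'a::vector_lattice)"
proof -
  have "pprt c - inf (pprt c) (- nprt c) = sup 0 (pprt c - (- nprt c))"
    by (simp only: diff_inf_eq_sup add_sup_distrib_left) simp
  also have "pprt c - (- nprt c) = c" using prts[of c] by simp
  finally show ?thesis by (simp add: pprt_def sup_commute)
qed

lemma inf_scaleR_le:
  fixes a x :: "'a::vector_lattice"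
  assumes r: "1 \<le> r" and "0 \<le> a" "0 \<le> x"
  shows "inf a (r *\<^sub>R x) \<le> r *\<^sub>R inf a x"
proof -
  have p: "0 < r" using r by simp
  let ?t = "inf a (r *\<^sub>R x)"
  have "0 \<le> ?t" using assms scaleR_nonneg_nonneg[of r x] by simp
  then have "inverse r *\<^sub>R ?t \<le> 1 *\<^sub>R ?t"
    using r by (intro scaleR_right_mono) (simp_all add: inverse_le_1_iff)
  then have 1: "inverse r *\<^sub>R ?t \<le> a" using inf_le1[of a "r *\<^sub>R x"]
    by (simp only: scaleR_one)
  have "inverse r *\<^sub>R ?t \<le> inverse r *\<^sub>R (r *\<^sub>R x)"
    using p by (intro scaleR_left_mono) auto
  then have "inverse r *\<^sub>R ?t \<le> x" using p by simp
  with 1 have "r *\<^sub>R (inverse r *\<^sub>R ?t) \<le> r *\<^sub>R inf a x"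
    using p by (intro scaleR_left_mono) auto
  then show ?thesis using p by simp
qed

lemma archimedean_le_zero:
  fixes c y :: "'a::dedekind_complete_vector_lattice"
  assumes le: "\<And>n. real (Suc n) *\<^sub>R c \<le> y"
  shows "c \<le> 0"
proof -
  let ?D = "range (\<lambda>n. real (Suc n) *\<^sub>R c)"
  have bdd: "bdd_above ?D" using le by (auto intro!: bdd_aboveI[of _ y])
  have "Sup ?D \<le> Sup ?D - c"
  proof (rule cSup_least)
    fix d assume "d \<in> ?D"
    then obtain n where d: "d = real (Suc n) *\<^sub>R c" by auto
    have "real (Suc (Suc n)) *\<^sub>R c \<le> Sup ?D" by (rule cSup_upper[OF _ bdd]) blast
    moreover have "real (Suc (Suc n)) *\<^sub>R c = d + c"
      unfolding d of_nat_Suc[of "Suc n"] scaleR_add_left by (simp only: scaleR_one add.commute)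
    ultimately show "d \<le> Sup ?D - c" by (simp add: le_diff_eq)
  qed simp
  then show ?thesis by (simp add: le_diff_eq)
qed

lemma le_zero_if_le_all_fractions:
  fixes z c :: "'a::dedekind_complete_vector_lattice"
  assumes "\<And>n. z \<le> inverse (real (Suc n)) *\<^sub>R c"
  shows "z \<le> 0"
proof (rule archimedean_le_zero)
  fix n
  have "real (Suc n) *\<^sub>R z \<le> real (Suc n) *\<^sub>R (inverse (real (Suc n)) *\<^sub>R c)"
    by (rule scaleR_left_mono[OF assms]) simp
  also have "\<dots> = c" by (simp del: of_nat_Suc)
  finally show "real (Suc n) *\<^sub>R z \<le> c" .
qed

text \<open>As \<open>c = u \<and> x\<close> lies below both \<open>u\<close> and \<open>x\<close>, it satisfies \<open>c \<le> (y - n c)\<^sup>+\<close> for all \<open>n\<close>. By induction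
  \<open>n c \<le> y\<close> for all \<open>n\<close>, so that \<open>c \<le> 0\<close> by the Archimedean property.\<close>

lemma inf_eq_zero_if_le_excess:
  fixes u x y :: "'a::dedekind_complete_vector_lattice"
  assumes u: "0 \<le> u" and x: "0 \<le> x" and y: "0 \<le> y"
    and le: "\<And>n. u \<le> sup (y - real n *\<^sub>R x) 0"
  shows "inf u x = 0"
proof (rule antisym)
  let ?c = "inf u x"
  have le': "?c \<le> sup (y - real n *\<^sub>R ?c) 0" for n
  proof -
    have "real n *\<^sub>R ?c \<le> real n *\<^sub>R x" by (intro scaleR_left_mono) auto
    then have "sup (y - real n *\<^sub>R x) 0 \<le> sup (y - real n *\<^sub>R ?c) 0"
      by (meson diff_left_mono sup_mono order_refl)
    then show ?thesis using le[of n] by (meson order_trans inf_le1)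
  qed
  have "real n *\<^sub>R ?c \<le> y" for n
  proof (induction n)
    case 0 then show ?case using y by simp
  next
    case (Suc n)
    then have "sup (y - real n *\<^sub>R ?c) 0 = y - real n *\<^sub>R ?c" by (simp add: sup_absorb1)
    then have "?c \<le> y - real n *\<^sub>R ?c" using le'[of n] by simp
    then have "real n *\<^sub>R ?c + ?c \<le> y" by (simp only: le_diff_eq add.commute)
    then show ?case by (simp only: of_nat_Suc scaleR_add_left scaleR_one add.commute)
  qed
  then show "?c \<le> 0" by (rule archimedean_le_zero)
  show "0 \<le> ?c" using u x by simp
qed

section \<open>Order null families along a filter\<close>

text \<open>Order convergence to zero, with the dominating net replaced by the set of all eventual upper bounds.
  A filter in place of a net makes passing to products and images of index sets a matter of
  filter calculus.\<close>

definition order_null :: "'i filter \<Rightarrow> ('i \<Rightarrow> 'a::vector_lattice) \<Rightarrow> bool" where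
  "order_null F f \<longleftrightarrow> (\<exists>w. \<forall>\<^sub>F i in F. \<bar>f i\<bar> \<le> w) \<and>
     (\<forall>z. (\<forall>w. (\<forall>\<^sub>F i in F. \<bar>f i\<bar> \<le> w) \<longrightarrow> z \<le> w) \<longrightarrow> z \<le> 0)"

lemma order_nullI:
  assumes "\<forall>\<^sub>F i in F. \<bar>f i\<bar> \<le> w"
    and "\<And>z. (\<And>w. \<forall>\<^sub>F i in F. \<bar>f i\<bar> \<le> w \<Longrightarrow> z \<le> w) \<Longrightarrow> z \<le> 0"
  shows "order_null F f"
  using assms unfolding order_null_def by blast

lemma order_nullD:
  assumes "order_null F f" and "\<And>w. \<forall>\<^sub>F i in F. \<bar>f i\<bar> \<le> w \<Longrightarrow> z \<le> w"
  shows "z \<le> 0"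
  using assms unfolding order_null_def by blast

lemma order_null_bound:
  assumes "order_null F f" obtains w where "\<forall>\<^sub>F i in F. \<bar>f i\<bar> \<le> w"
  using assms unfolding order_null_def by blast

lemma order_null_mono:
  assumes g: "order_null F g" and le: "\<forall>\<^sub>F i in F. \<bar>f i\<bar> \<le> \<bar>g i\<bar>"
  shows "order_null F f"
proof -
  have up: "\<forall>\<^sub>F i in F. \<bar>f i\<bar> \<le> w" if "\<forall>\<^sub>F i in F. \<bar>g i\<bar> \<le> w" for w
    using that le by eventually_elim (rule order_trans)
  obtain w where "\<forall>\<^sub>F i in F. \<bar>g i\<bar> \<le> w" using order_null_bound[OF g] .
  from up[OF this] show ?thesis
    by (rule order_nullI) (rule order_nullD[OF g], use up in blast)
qed

lemma order_null_bot: "order_null bot f"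
proof (rule order_nullI[where w = 0])
  fix z assume "\<And>w. \<forall>\<^sub>F i in bot. \<bar>f i\<bar> \<le> w \<Longrightarrow> z \<le> w"
  then show "z \<le> 0" by simp
qed simp

lemma order_null_filtermap: "order_null (filtermap h F) f \<longleftrightarrow> order_null F (\<lambda>i. f (h i))"
  unfolding order_null_def eventually_filtermap ..

lemma order_null_compose:
  assumes "order_null F f" "filterlim h F G"
  shows "order_null G (\<lambda>i. f (h i))"
proof -
  have up: "\<forall>\<^sub>F i in G. \<bar>f (h i)\<bar> \<le> w" if "\<forall>\<^sub>F i in F. \<bar>f i\<bar> \<le> w" for w
    using eventually_compose_filterlim[OF that assms(2)] .
  obtain w where "\<forall>\<^sub>F i in F. \<bar>f i\<bar> \<le> w" using order_null_bound[OF assms(1)] .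
  from up[OF this] show ?thesis
    by (rule order_nullI) (rule order_nullD[OF assms(1)], use up in blast)
qed

lemma order_null_add:
  assumes f: "order_null F f" and g: "order_null F g"
  shows "order_null F (\<lambda>i. f i + g i)"
proof -
  have up: "\<forall>\<^sub>F i in F. \<bar>f i + g i\<bar> \<le> v + w"
    if "\<forall>\<^sub>F i in F. \<bar>f i\<bar> \<le> v" "\<forall>\<^sub>F i in F. \<bar>g i\<bar> \<le> w" for v w
    using that by eventually_elim (meson abs_triangle_ineq add_mono order_trans)
  obtain v w where vw: "\<forall>\<^sub>F i in F. \<bar>f i\<bar> \<le> v" "\<forall>\<^sub>F i in F. \<bar>g i\<bar> \<le> w"
    using f g unfolding order_null_def by blast
  show ?thesis
  proof (rule order_nullI[OF up[OF vw]])
    fix z assume z: "\<And>w. \<forall>\<^sub>F i in F. \<bar>f i + g i\<bar> \<le> w \<Longrightarrow> z \<le> w"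
    show "z \<le> 0"
    proof (rule order_nullD[OF f])
      fix v assume v: "\<forall>\<^sub>F i in F. \<bar>f i\<bar> \<le> v"
      have "z - v \<le> 0"
      proof (rule order_nullD[OF g])
        fix w assume w: "\<forall>\<^sub>F i in F. \<bar>g i\<bar> \<le> w"
        show "z - v \<le> w" using z[OF up[OF v w]] by (simp only: diff_le_eq add.commute)
      qed
      then show "z \<le> v" by simp
    qed
  qed
qed

text \<open>The estimate needs to be good only up to an arbitrarily small multiple of a fixed element, at the
  cost of a large multiple of the null family.\<close>

lemma order_null_approx:
  fixes f g :: "'i \<Rightarrow> 'a::dedekind_complete_vector_lattice"
  assumes g: "order_null F g" 
    and le: "\<And>n. \<forall>\<^sub>F i in F. \<bar>f i\<bar> \<le> real (Suc n) *\<^sub>R \<bar>g i\<bar> + inverse (real (Suc n)) *\<^sub>R c"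
  shows "order_null F f"
proof -
  have up: "\<forall>\<^sub>F i in F. \<bar>f i\<bar> \<le> real (Suc n) *\<^sub>R w + inverse (real (Suc n)) *\<^sub>R c"
    if "\<forall>\<^sub>F i in F. \<bar>g i\<bar> \<le> w" for w n
    using that le[of n]
  proof eventually_elim
    case (elim i)
    have "real (Suc n) *\<^sub>R \<bar>g i\<bar> \<le> real (Suc n) *\<^sub>R w"
      using elim(1) by (rule scaleR_left_mono) simp
    then show ?case using elim(2) by (meson add_right_mono order_trans)
  qed
  obtain w where w: "\<forall>\<^sub>F i in F. \<bar>g i\<bar> \<le> w" using order_null_bound[OF g] .
  show ?thesis
  proof (rule order_nullI[OF up[OF w, of 0]])
    fix z assume z: "\<And>w. \<forall>\<^sub>F i in F. \<bar>f i\<bar> \<le> w \<Longrightarrow> z \<le> w"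
    show "z \<le> 0"
    proof (rule le_zero_if_le_all_fractions)
      fix n
      let ?d = "inverse (real (Suc n)) *\<^sub>R (z - inverse (real (Suc n)) *\<^sub>R c)"
      have "?d \<le> 0"
      proof (rule order_nullD[OF g])
        fix w assume "\<forall>\<^sub>F i in F. \<bar>g i\<bar> \<le> w"
        from z[OF up[OF this, of n]]
        have "z - inverse (real (Suc n)) *\<^sub>R c \<le> real (Suc n) *\<^sub>R w" by (simp only: diff_le_eq)
        then have "?d \<le> inverse (real (Suc n)) *\<^sub>R (real (Suc n) *\<^sub>R w)"
          by (rule scaleR_left_mono) simp
        then show "?d \<le> w" by (simp del: of_nat_Suc)
      qed
      then have "real (Suc n) *\<^sub>R ?d \<le> real (Suc n) *\<^sub>R 0" by (rule scaleR_left_mono) simp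
      then show "z \<le> inverse (real (Suc n)) *\<^sub>R c" by (simp del: of_nat_Suc)
    qed
  qed
qed

section \<open>Nets and their tail filters\<close>

definition tail_filter :: "'i set \<Rightarrow> ('i \<Rightarrow> 'i \<Rightarrow> bool) \<Rightarrow> 'i filter" where
  "tail_filter I le = (INF i\<in>I. principal {j\<in>I. le i j})"

lemma eventually_tail_filter:
  assumes "directed_set I le"
  shows "eventually P (tail_filter I le) \<longleftrightarrow> (\<exists>i\<in>I. \<forall>j\<in>I. le i j \<longrightarrow> P j)"
  unfolding tail_filter_def
proof (subst eventually_INF_base)
  show "I \<noteq> {}" using assms unfolding directed_set_def by blast
  fix a b assume ab: "a \<in> I" "b \<in> I"
  then obtain k where k: "k \<in> I" "le a k" "le b k"
    using assms unfolding directed_set_def by blast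
  have "{j\<in>I. le k j} \<subseteq> {j\<in>I. le a j} \<inter> {j\<in>I. le b j}"
    using assms ab k unfolding directed_set_def by blast
  then show "\<exists>x\<in>I. principal {j\<in>I. le x j} \<le> inf (principal {j\<in>I. le a j}) (principal {j\<in>I. le b j})"
    using k(1) by auto
qed (auto simp: eventually_principal)

lemma tail_filter_neq_bot:
  assumes "directed_set I le" shows "tail_filter I le \<noteq> bot"
proof -
  have "\<not> eventually (\<lambda>_. False) (tail_filter I le)"
    unfolding eventually_tail_filter[OF assms] using assms unfolding directed_set_def by blast
  then show ?thesis by (simp add: trivial_limit_def)
qed

text \<open>Two eventual upper bounds have an infimum that is again one, so they form a net decreasing to zero
  as soon as their infimum is zero.\<close>

lemma order_converges_iff_order_null:
  assumes dir: "directed_set I le"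
  shows "order_converges I le f 0 \<longleftrightarrow> order_null (tail_filter I le) f"
proof
  assume "order_converges I le f 0"
  then obtain J :: "'b set" and le' y where y: "decreases_to_zero J le' y"
    and dom: "\<And>j. j \<in> J \<Longrightarrow> \<exists>i0\<in>I. \<forall>i\<in>I. le i0 i \<longrightarrow> \<bar>0 - f i\<bar> \<le> y j"
    unfolding order_converges_def by blast
  have ev: "\<forall>\<^sub>F i in tail_filter I le. \<bar>f i\<bar> \<le> y j" if "j \<in> J" for j
    using dom[OF that] unfolding eventually_tail_filter[OF dir] by simp
  obtain j where "j \<in> J" using y unfolding decreases_to_zero_def directed_set_def by blast
  from ev[OF this] show "order_null (tail_filter I le) f"
  proof (rule order_nullI)
    fix z assume "\<And>w. \<forall>\<^sub>F i in tail_filter I le. \<bar>f i\<bar> \<le> w \<Longrightarrow> z \<le> w"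
    then have "\<forall>j\<in>J. z \<le> y j" using ev by blast
    then show "z \<le> 0" using y unfolding decreases_to_zero_def is_infimum_def by simp
  qed
next
  assume null: "order_null (tail_filter I le) f"
  let ?J = "{w. \<forall>\<^sub>F i in tail_filter I le. \<bar>f i\<bar> \<le> w}"
  have "\<exists>k\<in>?J. k \<le> i \<and> k \<le> j" if "i \<in> ?J" "j \<in> ?J" for i j
    using that by (intro bexI[of _ "inf i j"]) (auto intro: eventually_conj)
  moreover obtain w where "w \<in> ?J" using order_null_bound[OF null] by blast
  ultimately have "directed_set ?J (\<lambda>u v. v \<le> u)" unfolding directed_set_def
    by (auto intro: order_trans)
  moreover have "0 \<le> w" if "w \<in> ?J" for w
  proof -
    have "\<exists>i. \<bar>f i\<bar> \<le> w"
      using that eventually_happens[of "\<lambda>i. \<bar>f i\<bar> \<le> w"] tail_filter_neq_bot[OF dir] by blast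
    then show ?thesis by (meson abs_ge_zero order_trans)
  qed
  then have "is_infimum ?J 0"
    unfolding is_infimum_def using order_nullD[OF null] by blast
  ultimately have "decreases_to_zero ?J (\<lambda>u v. v \<le> u) (\<lambda>u. u)"
    unfolding decreases_to_zero_def by simp
  then show "order_converges I le f 0"
    unfolding order_converges_def
    by (intro exI[of _ ?J] exI conjI) (auto simp: eventually_tail_filter[OF dir])
qed

lemma uo_converges_iff_order_null:
  assumes "directed_set I le"
  shows "uo_converges I le x l \<longleftrightarrow>
    (\<forall>y\<ge>0. order_null (tail_filter I le) (\<lambda>i. inf \<bar>x i - l\<bar> y))"
  unfolding uo_converges_def order_converges_iff_order_null[OF assms] ..

section \<open>Disjointness\<close>

definition disjoint_complement :: "'a::vector_lattice \<Rightarrow> 'a set" where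
  "disjoint_complement v = {u. inf \<bar>u\<bar> \<bar>v\<bar> = 0}"

lemma inf_abs_nonneg: "0 \<le> inf \<bar>a\<bar> \<bar>b :: 'a::vector_lattice\<bar>"
  by simp

lemma disjoint_complement_iff: "u \<in> disjoint_complement v \<longleftrightarrow> inf \<bar>u\<bar> \<bar>v\<bar> \<le> 0"
  unfolding disjoint_complement_def using inf_abs_nonneg[of u v] by (auto intro: antisym)

lemma disjoint_complement_sym: "u \<in> disjoint_complement v \<longleftrightarrow> v \<in> disjoint_complement u"
  by (simp add: disjoint_complement_def inf_commute)

lemma disjoint_complement_solid:
  assumes "u \<in> disjoint_complement v" "\<bar>w\<bar> \<le> \<bar>u\<bar>"
  shows "w \<in> disjoint_complement v"
  using assms unfolding disjoint_complement_iff by (meson inf_mono order_refl order_trans)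

lemma disjoint_add_le:
  fixes a b :: "'a::vector_lattice"
  assumes "inf a b \<le> 0" "a \<le> c" "b \<le> c" "0 \<le> a" "0 \<le> b"
  shows "a + b \<le> c"
proof -
  have "inf a b = 0" using assms by (intro antisym) simp_all
  then have "a + b = sup a b" using add_eq_inf_sup[of a b] by simp
  then show ?thesis using assms by simp
qed

lemma disjoint_abs_add_le:
  fixes a b :: "'a::vector_lattice"
  assumes "inf \<bar>a\<bar> \<bar>b\<bar> \<le> 0"
  shows "\<bar>a\<bar> + \<bar>b\<bar> \<le> \<bar>a - b\<bar>"
proof (rule disjoint_add_le[OF assms])
  let ?c = "\<bar>a - b\<bar>"
  have "\<bar>a\<bar> \<le> ?c + \<bar>b\<bar>" "\<bar>b\<bar> \<le> ?c + \<bar>a\<bar>"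
    using abs_triangle_ineq2[of a b] abs_triangle_ineq2[of b a]
    by (simp_all add: diff_le_eq abs_minus_commute)
  then have "\<bar>a\<bar> \<le> inf (?c + \<bar>a\<bar>) (?c + \<bar>b\<bar>)" "\<bar>b\<bar> \<le> inf (?c + \<bar>a\<bar>) (?c + \<bar>b\<bar>)"
    by simp_all
  moreover have "inf (?c + \<bar>a\<bar>) (?c + \<bar>b\<bar>) \<le> ?c"
    using assms by (simp flip: add_inf_distrib_left)
  ultimately show "\<bar>a\<bar> \<le> ?c" "\<bar>b\<bar> \<le> ?c" by (meson order_trans)+
qed simp_all

lemma abs_scaleR_le: "\<bar>r *\<^sub>R u\<bar> \<le> \<bar>r\<bar> *\<^sub>R \<bar>u :: 'a::vector_lattice\<bar>"
proof -
  have *: "\<bar>s *\<^sub>R w\<bar> \<le> s *\<^sub>R \<bar>w\<bar>" if "0 \<le> s" for s and w :: 'a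
    using scaleR_left_mono[OF abs_ge_self[of w] that]
      scaleR_left_mono[OF abs_ge_minus_self[of w] that] by (simp add: abs_leI)
  show ?thesis
  proof (cases "0 \<le> r")
    case False
    have "r *\<^sub>R u = - ((- r) *\<^sub>R u)" by simp
    then have "\<bar>r *\<^sub>R u\<bar> = \<bar>(- r) *\<^sub>R u\<bar>" by (metis abs_minus_cancel)
    then show ?thesis using *[of "- r" u] False by simp
  qed (use * in simp)
qed

lemma subspace_disjoint_complement: "subspace (disjoint_complement v)"
  unfolding subspace_def
proof (intro conjI ballI allI)
  show "0 \<in> disjoint_complement v" by (simp add: disjoint_complement_iff)
  fix u w assume u: "u \<in> disjoint_complement v"
  { assume w: "w \<in> disjoint_complement v"
    have "inf \<bar>u + w\<bar> \<bar>v\<bar> \<le> inf (\<bar>u\<bar> + \<bar>w\<bar>) \<bar>v\<bar>"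
      by (intro inf_mono abs_triangle_ineq order_refl)
    also have "\<dots> \<le> inf \<bar>u\<bar> \<bar>v\<bar> + inf \<bar>w\<bar> \<bar>v\<bar>" by (rule inf_add_le) simp_all
    also have "\<dots> = 0" using u w by (simp add: disjoint_complement_def)
    finally show "u + w \<in> disjoint_complement v" by (simp only: disjoint_complement_iff) }
  fix r :: real
  let ?s = "1 + \<bar>r\<bar>"
  have "\<bar>r *\<^sub>R u\<bar> \<le> ?s *\<^sub>R \<bar>u\<bar>"
    using abs_scaleR_le[of r u] scaleR_right_mono[of "\<bar>r\<bar>" ?s "\<bar>u\<bar>"]
    by (meson abs_ge_zero le_add_same_cancel2 order_trans zero_le_one)
  then have "inf \<bar>v\<bar> \<bar>r *\<^sub>R u\<bar> \<le> inf \<bar>v\<bar> (?s *\<^sub>R \<bar>u\<bar>)" by (intro inf_mono order_refl)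
  also have "\<dots> \<le> ?s *\<^sub>R inf \<bar>v\<bar> \<bar>u\<bar>" by (rule inf_scaleR_le) simp_all
  also have "\<dots> = 0" using u by (simp add: disjoint_complement_def inf_commute)
  finally show "r *\<^sub>R u \<in> disjoint_complement v" by (simp only: disjoint_complement_iff inf_commute)
qed

text \<open>For a set with supremum \<open>s\<close> and an element \<open>d\<^sub>0\<close>, put \<open>u = (s - d\<^sub>0) \<and> \<bar>v\<bar>\<close>. Each \<open>(d - d\<^sub>0)\<^sup>+\<close> is
  disjoint from \<open>u\<close>, so that the sum of the two is still at most \<open>s - d\<^sub>0\<close>; hence \<open>s - u\<close> is an upper bound
  as well, and \<open>u = 0\<close>.\<close>

lemma band_disjoint_complement: "band (disjoint_complement v)"
  unfolding band_def order_ideal_def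
proof (intro conjI allI impI subspace_disjoint_complement)
  fix x y assume "y \<in> disjoint_complement v \<and> \<bar>x\<bar> \<le> \<bar>y\<bar>"
  then show "x \<in> disjoint_complement v" using disjoint_complement_solid by blast
next
  fix D s assume Ds: "D \<subseteq> disjoint_complement v \<and> is_supremum D s"
  then have up: "\<And>d. d \<in> D \<Longrightarrow> d \<le> s" and least: "\<And>t. (\<And>d. d \<in> D \<Longrightarrow> d \<le> t) \<Longrightarrow> s \<le> t"
    unfolding is_supremum_def by blast+
  show "s \<in> disjoint_complement v"
  proof (cases "D = {}")
    case True
    then have "s \<le> s + s" "s \<le> 0" using least by blast+
    then have "s = 0" by (intro antisym) simp_all
    then show ?thesis by (simp add: disjoint_complement_iff)
  next
    case False
    then obtain d0 where d0: "d0 \<in> D" by blast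
    let ?u = "inf (s - d0) \<bar>v\<bar>"
    have s0: "0 \<le> s - d0" using up[OF d0] by simp
    have "s \<le> s - ?u"
    proof (rule least)
      fix d assume d: "d \<in> D"
      let ?a = "sup (d - d0) 0"
      have "d - d0 \<in> disjoint_complement v"
        using Ds d d0 by (intro subspace_diff[OF subspace_disjoint_complement]) auto
      moreover have "\<bar>?a\<bar> \<le> \<bar>d - d0\<bar>" by (simp add: abs_of_nonneg abs_ge_self)
      ultimately have "inf ?a \<bar>v\<bar> \<le> 0"
        using disjoint_complement_solid[of "d - d0" v ?a]
        by (simp add: disjoint_complement_iff abs_of_nonneg)
      then have "inf ?a ?u \<le> 0" by (meson inf_mono inf_le2 order_refl order_trans)
      then have "?a + ?u \<le> s - d0"
        using up[OF d] s0 by (intro disjoint_add_le) simp_all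
      moreover have "d - d0 \<le> ?a" by simp
      ultimately have "d - d0 + ?u \<le> s - d0" by (meson add_right_mono order_trans)
      then show "d \<le> s - ?u" by (simp add: algebra_simps)
    qed
    then have "?u \<le> 0" by simp
    then have "s - d0 \<in> disjoint_complement v"
      using s0 by (simp add: disjoint_complement_iff abs_of_nonneg)
    then have "(s - d0) + d0 \<in> disjoint_complement v"
      using Ds d0 by (intro subspace_add[OF subspace_disjoint_complement]) auto
    then show ?thesis by simp
  qed
qed

section \<open>Lattice operations of orthomorphisms\<close>

lemmas ob_apply_linear = linear_add[OF linear_ob_apply] linear_diff[OF linear_ob_apply]
  linear_neg[OF linear_ob_apply] linear_scale[OF linear_ob_apply] linear_0[OF linear_ob_apply]

lemma ob_apply_nonneg: "0 \<le> S \<Longrightarrow> 0 \<le> x \<Longrightarrow> 0 \<le> ob_apply S x"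
  by (simp add: less_eq_ob_op.rep_eq)

lemma ob_apply_mono: "0 \<le> S \<Longrightarrow> x \<le> y \<Longrightarrow> ob_apply S x \<le> ob_apply S y"
  using ob_apply_nonneg[of S "y - x"] by (simp add: ob_apply_linear)

lemma ob_apply_le: "S \<le> T \<Longrightarrow> 0 \<le> x \<Longrightarrow> ob_apply S x \<le> ob_apply T x"
  by (simp add: less_eq_ob_op.rep_eq)

lemma abs_ob_apply_le:
  fixes T V :: "'a::vector_lattice ob_op"
  assumes "T \<le> V" "- T \<le> V"
  shows "\<bar>ob_apply T x\<bar> \<le> ob_apply V \<bar>x\<bar>"
proof -
  have pos: "\<bar>ob_apply T a\<bar> \<le> ob_apply V a" if "0 \<le> a" for a
    using ob_apply_le[OF assms(1) that] ob_apply_le[OF assms(2) that] by (simp add: abs_leI)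
  have "ob_apply T x = ob_apply T (pprt x) + ob_apply T (nprt x)"
    using arg_cong[OF prts[of x], of "ob_apply T"] by (simp add: ob_apply_linear)
  then have "ob_apply T x = ob_apply T (pprt x) - ob_apply T (- nprt x)"
    by (simp add: ob_apply_linear)
  then have "\<bar>ob_apply T x\<bar> \<le> \<bar>ob_apply T (pprt x)\<bar> + \<bar>ob_apply T (- nprt x)\<bar>"
    by (simp only: abs_triangle_ineq4)
  also have "\<dots> \<le> ob_apply V (pprt x) + ob_apply V (- nprt x)"
    by (intro add_mono pos) simp_all
  also have "\<dots> = ob_apply V \<bar>x\<bar>" by (simp add: abs_prts ob_apply_linear)
  finally show ?thesis .
qed

lemma Orth_disjoint:
  assumes "T \<in> Orth" "u \<in> disjoint_complement v"
  shows "ob_apply T u \<in> disjoint_complement v"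
  using assms band_disjoint_complement unfolding Orth_def by blast

text \<open>By the hypotheses \<open>V\<close> is positive and \<open>\<bar>U x\<bar> \<le> V \<bar>x\<bar>\<close>.\<close>

lemma Orth_dominated:
  fixes U V :: "'a::vector_lattice ob_op"
  assumes V: "V \<in> Orth" and "U \<le> V" "- U \<le> V"
  shows "U \<in> Orth"
  unfolding Orth_def
proof (clarify)
  fix B :: "'a set" and x assume B: "band B" and x: "x \<in> B"
  have solid: "\<And>x y. y \<in> B \<Longrightarrow> \<bar>x\<bar> \<le> \<bar>y\<bar> \<Longrightarrow> x \<in> B"
    using B unfolding band_def order_ideal_def by blast
  have "ob_apply V \<bar>x\<bar> \<in> B" using V B solid[OF x, of "\<bar>x\<bar>"] unfolding Orth_def by auto
  moreover have "\<bar>ob_apply U x\<bar> \<le> \<bar>ob_apply V \<bar>x\<bar>\<bar>"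
    using abs_ob_apply_le[OF assms(2,3), of x] by (meson abs_ge_self order_trans)
  ultimately show "ob_apply U x \<in> B" by (rule solid)
qed

lemma subspace_Orth: "subspace (Orth :: 'a::dedekind_complete_vector_lattice ob_op set)"
  and Orth_mult: "S \<in> Orth \<Longrightarrow> T \<in> Orth \<Longrightarrow> S * T \<in> (Orth :: 'a ob_op set)"
  and Orth_sup: "S \<in> Orth \<Longrightarrow> T \<in> Orth \<Longrightarrow> sup S T \<in> (Orth :: 'a ob_op set)"
  and Orth_inf: "S \<in> Orth \<Longrightarrow> T \<in> Orth \<Longrightarrow> inf S T \<in> (Orth :: 'a ob_op set)"
  using vector_lattice_subalgebra_Orth
  unfolding vector_lattice_subalgebra_of_Orth_def subalgebra_of_Orth_def vector_sublattice_def
  by blast+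

lemma Orth_abs: "T \<in> Orth \<Longrightarrow> \<bar>T\<bar> \<in> (Orth :: 'a::dedekind_complete_vector_lattice ob_op set)"
  unfolding abs_lattice by (intro Orth_sup) (auto intro: subspace_neg[OF subspace_Orth])

lemma Orth_ob_pos: "T \<in> Orth \<Longrightarrow> ob_pos T \<in> (Orth :: 'a::dedekind_complete_vector_lattice ob_op set)"
  using Orth_sup[of 0 T] subspace_0[OF subspace_Orth] by (simp add: sup_ob_op_def)

text \<open>With \<open>m = y \<and> z\<close>, \<open>a = (y - z)\<^sup>+\<close> and \<open>b = (z - y)\<^sup>+\<close> one has \<open>y = m + a\<close>, \<open>z = m + b\<close> and
  \<open>a \<and> b = 0\<close>. Expanding both sides, all that is needed is \<open>S a \<and> T b = 0\<close>, which holds because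
  \<open>S\<close> and \<open>T\<close> preserve disjointness.\<close>

lemma Orth_inf_le_split:
  fixes S T :: "'a::vector_lattice ob_op"
  assumes S: "S \<in> Orth" "0 \<le> S" and T: "T \<in> Orth" "0 \<le> T" and y: "0 \<le> y" and z: "0 \<le> z"
  shows "inf (ob_apply S (y + z)) (ob_apply T (y + z)) \<le> 2 *\<^sub>R (ob_apply S z + ob_apply T y)"
proof -
  obtain m a b where m: "0 \<le> m" and a: "0 \<le> a" and b: "0 \<le> b"
    and yz: "y = m + a" "z = m + b" and "inf a b = 0"
  proof
    show "inf (y - inf y z) (z - inf y z) = 0"
      using add_inf_distrib_right[of y z "- inf y z"] by simp
  qed (use y z in simp_all)
  then have "a \<in> disjoint_complement b" by (simp add: disjoint_complement_iff abs_of_nonneg)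
  then have "ob_apply T b \<in> disjoint_complement (ob_apply S a)"
    using Orth_disjoint[OF S(1)] Orth_disjoint[OF T(1)] disjoint_complement_sym by blast
  then have disj: "inf (ob_apply S a) (ob_apply T b) \<le> 0"
    using ob_apply_nonneg[OF S(2) a] ob_apply_nonneg[OF T(2) b]
    by (simp add: disjoint_complement_iff abs_of_nonneg inf_commute)
  note n = ob_apply_nonneg[OF S(2) m] ob_apply_nonneg[OF S(2) b]
    ob_apply_nonneg[OF T(2) m] ob_apply_nonneg[OF T(2) a]
  define k where "k = 2 *\<^sub>R (ob_apply S m + ob_apply T m) + ob_apply S b + ob_apply T a"
  have "k + ob_apply S a - ob_apply S (y + z) = ob_apply T m + ob_apply T m + ob_apply T a"
    unfolding k_def yz linear_add[OF linear_ob_apply] by (simp add: scaleR_2)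
  also have "\<dots> \<ge> 0" using n by (intro add_nonneg_nonneg)
  finally have S1: "ob_apply S (y + z) \<le> k + ob_apply S a" by (simp only: le_diff_eq add_0)
  have "k + ob_apply T b - ob_apply T (y + z) = ob_apply S m + ob_apply S m + ob_apply S b"
    unfolding k_def yz linear_add[OF linear_ob_apply] by (simp add: scaleR_2)
  also have "\<dots> \<ge> 0" using n by (intro add_nonneg_nonneg)
  finally have T1: "ob_apply T (y + z) \<le> k + ob_apply T b" by (simp only: le_diff_eq add_0)
  have "inf (ob_apply S (y + z)) (ob_apply T (y + z)) \<le> inf (k + ob_apply S a) (k + ob_apply T b)"
    using S1 T1 by (rule inf_mono)
  also have "\<dots> = k + inf (ob_apply S a) (ob_apply T b)" by (simp only: add_inf_distrib_left)
  also have "\<dots> \<le> k" using disj by simp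
  also have "k \<le> 2 *\<^sub>R (ob_apply S z + ob_apply T y)"
  proof -
    have "2 *\<^sub>R (ob_apply S z + ob_apply T y) - k = ob_apply S b + ob_apply T a"
      unfolding k_def yz linear_add[OF linear_ob_apply] by (simp add: scaleR_2)
    also have "\<dots> \<ge> 0" using n by (intro add_nonneg_nonneg)
    finally show ?thesis by (simp only: le_diff_eq add_0)
  qed
  finally show ?thesis .
qed

text \<open>Let \<open>S = T\<^sup>+\<close> and \<open>R = T\<^sup>-\<close>. By the previous estimate \<open>S x \<and> R x \<le> 2 (S (x - y) + R y) = 2 (S x - T y)\<close> for
  all \<open>y\<close> in \<open>[0,x]\<close>, and \<open>S x\<close> is the supremum of these \<open>T y\<close>. Hence \<open>S x \<and> R x = 0\<close>, so that
  \<open>S x = (S x - R x)\<^sup>+ = (T x)\<^sup>+\<close>.\<close>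

lemma ob_apply_ob_pos_Orth:
  fixes T :: "'a::dedekind_complete_vector_lattice ob_op"
  assumes T: "T \<in> Orth" and x: "0 \<le> x"
  shows "ob_apply (ob_pos T) x = sup (ob_apply T x) 0"
proof -
  let ?S = "ob_pos T" and ?R = "ob_pos T - T"
  have S: "?S \<in> Orth" "0 \<le> ?S" and R: "?R \<in> Orth" "0 \<le> ?R"
    using Orth_ob_pos[OF T] subspace_diff[OF subspace_Orth _ T] is_supremum_ob_pos[of T]
    unfolding is_supremum_def by auto
  let ?u = "inf (ob_apply ?S x) (ob_apply ?R x)"
  have "ob_apply ?S x \<le> ob_apply ?S x - (1/2) *\<^sub>R ?u"
    unfolding ob_pos_apply[OF x]
  proof (rule cSup_least)
    show "ob_apply T ` {0..x} \<noteq> {}" using x by auto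
    fix t assume "t \<in> ob_apply T ` {0..x}"
    then obtain y where y: "0 \<le> y" "y \<le> x" and t: "t = ob_apply T y" by auto
    have "?u \<le> 2 *\<^sub>R (ob_apply ?S (x - y) + ob_apply ?R y)"
      using Orth_inf_le_split[OF S R y(1), of "x - y"] y by simp
    also have "ob_apply ?S (x - y) + ob_apply ?R y = ob_apply ?S x - t"
      by (simp add: t ob_apply_linear)
    finally have "(1/2) *\<^sub>R ?u \<le> (1/2) *\<^sub>R (2 *\<^sub>R (ob_apply ?S x - t))"
      by (rule scaleR_left_mono) simp
    then have "(1/2) *\<^sub>R ?u \<le> ob_apply ?S x - t" by simp
    then show "t \<le> Sup (ob_apply T ` {0..x}) - (1/2) *\<^sub>R inf (Sup (ob_apply T ` {0..x})) (ob_apply ?R x)"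
      unfolding ob_pos_apply[OF x] by (simp only: le_diff_eq add.commute)
  qed
  then have "(1/2) *\<^sub>R ?u \<le> 0" by simp
  then have "2 *\<^sub>R ((1/2) *\<^sub>R ?u) \<le> 2 *\<^sub>R 0" by (rule scaleR_left_mono) simp
  then have "?u = 0" using ob_apply_nonneg[OF S(2) x] ob_apply_nonneg[OF R(2) x]
    by (intro antisym) simp_all
  then have "ob_apply ?S x - ?u = ob_apply ?S x" by simp
  moreover have "ob_apply ?S x - ?u = sup 0 (ob_apply ?S x - ob_apply ?R x)"
    by (simp only: diff_inf_eq_sup add_sup_distrib_left) simp
  ultimately show ?thesis by (simp add: sup_commute)
qed

lemma ob_apply_sup_Orth:
  fixes S T :: "'a::dedekind_complete_vector_lattice ob_op"
  assumes "S \<in> Orth" "T \<in> Orth" "0 \<le> x"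
  shows "ob_apply (sup S T) x = sup (ob_apply S x) (ob_apply T x)"
proof -
  have "ob_apply (sup S T) x = ob_apply S x + sup (ob_apply T x - ob_apply S x) 0"
    using ob_apply_ob_pos_Orth[OF subspace_diff[OF subspace_Orth assms(2,1)] assms(3)]
    by (simp add: sup_ob_op_def)
  then show ?thesis by (simp add: add_sup_distrib_left sup_commute)
qed

lemma ob_apply_inf_Orth:
  fixes S T :: "'a::dedekind_complete_vector_lattice ob_op"
  assumes "S \<in> Orth" "T \<in> Orth" "0 \<le> x"
  shows "ob_apply (inf S T) x = inf (ob_apply S x) (ob_apply T x)"
proof -
  have "ob_apply (inf S T) x + ob_apply (sup S T) x = ob_apply S x + ob_apply T x"
    using add_eq_inf_sup[of S T] by (metis ob_apply_simps(2) add.commute)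
  then show ?thesis
    using add_eq_inf_sup[of "ob_apply S x" "ob_apply T x"]
    by (simp add: ob_apply_sup_Orth[OF assms] add.commute)
qed

text \<open>The images of \<open>x\<^sup>+\<close> and \<open>x\<^sup>-\<close> are disjoint, so the absolute value of their difference is the sum of
  their absolute values.\<close>

lemma ob_apply_abs_Orth:
  fixes T :: "'a::dedekind_complete_vector_lattice ob_op"
  assumes T: "T \<in> Orth"
  shows "ob_apply \<bar>T\<bar> \<bar>x\<bar> = \<bar>ob_apply T x\<bar>"
proof -
  have pos: "ob_apply \<bar>T\<bar> a = \<bar>ob_apply T a\<bar>" if "0 \<le> a" for a
    using ob_apply_sup_Orth[OF T subspace_neg[OF subspace_Orth T] that] by (simp add: abs_lattice)
  let ?p = "pprt x" and ?n = "- nprt x"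
  have p: "0 \<le> ?p" and n: "0 \<le> ?n" by simp_all
  have "inf ?p ?n = 0" by (rule inf_pprt_nprt)
  then have "?p \<in> disjoint_complement ?n" using p n by (simp add: disjoint_complement_iff abs_of_nonneg)
  then have "inf \<bar>ob_apply T ?p\<bar> \<bar>ob_apply T ?n\<bar> \<le> 0"
    using Orth_disjoint[OF T] disjoint_complement_sym disjoint_complement_iff by metis
  then have "\<bar>ob_apply T ?p\<bar> + \<bar>ob_apply T ?n\<bar> \<le> \<bar>ob_apply T ?p - ob_apply T ?n\<bar>"
    by (rule disjoint_abs_add_le)
  also have "ob_apply T ?p - ob_apply T ?n = ob_apply T x"
    using arg_cong[OF prts[of x], of "ob_apply T"] by (simp add: ob_apply_linear)
  finally have "ob_apply \<bar>T\<bar> \<bar>x\<bar> \<le> \<bar>ob_apply T x\<bar>"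
    by (simp only: pos[OF p, symmetric] pos[OF n, symmetric] linear_add[OF linear_ob_apply, symmetric]
        abs_prts[of x] diff_conv_add_uminus)
  moreover have "\<bar>ob_apply T x\<bar> \<le> ob_apply \<bar>T\<bar> \<bar>x\<bar>"
    by (rule abs_ob_apply_le) (rule abs_ge_self abs_ge_minus_self)+
  ultimately show ?thesis by (rule antisym)
qed

section \<open>Suprema of directed families of operators\<close>

lemma ob_op_extension:
  fixes f :: "'a::dedekind_complete_vector_lattice \<Rightarrow> 'a"
  assumes add: "\<And>x y. 0 \<le> x \<Longrightarrow> 0 \<le> y \<Longrightarrow> f (x + y) = f x + f y"
    and scale: "\<And>r x. 0 \<le> r \<Longrightarrow> 0 \<le> x \<Longrightarrow> f (r *\<^sub>R x) = r *\<^sub>R f x"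
    and lower: "\<And>x. 0 \<le> x \<Longrightarrow> ob_apply S x \<le> f x"
    and upper: "\<And>x. 0 \<le> x \<Longrightarrow> f x \<le> ob_apply R x"
  obtains V where "\<And>x. 0 \<le> x \<Longrightarrow> ob_apply V x = f x"
proof -
  define g where "g z = f (pprt z) - f (- nprt z)" for z
  have g_diff: "g (a - b) = f a - f b" if ab: "0 \<le> a" "0 \<le> b" for a b
  proof -
    let ?x = "a - b"
    have "pprt ?x + b = - nprt ?x + a" using prts[of ?x] by (simp add: algebra_simps)
    then have "f (pprt ?x) + f b = f (- nprt ?x) + f a"
      using ab add[of "pprt ?x" b] add[of "- nprt ?x" a] by simp
    then show ?thesis unfolding g_def by (simp add: algebra_simps)
  qed
  have f0: "f 0 = 0" using scale[of 0 0] by simp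
  have g_pos: "g x = f x" if "0 \<le> x" for x using g_diff[of x 0] that f0 by simp
  have split: "\<exists>a b. 0 \<le> a \<and> 0 \<le> b \<and> z = a - b" for z :: 'a
    using prts[of z] by (intro exI[of _ "pprt z"] exI[of _ "- nprt z"]) simp
  have g_add: "g (x + y) = g x + g y" for x y
  proof -
    obtain a b c d where ab: "0 \<le> a" "0 \<le> b" "x = a - b" and cd: "0 \<le> c" "0 \<le> d" "y = c - d"
      using split[of x] split[of y] by blast
    have xy: "x + y = (a + c) - (b + d)" using ab cd by simp
    have "g (x + y) = f (a + c) - f (b + d)" unfolding xy using ab cd by (intro g_diff) simp_all
    moreover have "g x = f a - f b" "g y = f c - f d" using ab cd g_diff by simp_all
    ultimately show ?thesis using ab(1,2) cd(1,2) by (simp add: add)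
  qed
  have g_scale: "g (r *\<^sub>R x) = r *\<^sub>R g x" for r x
  proof -
    obtain a b where ab: "0 \<le> a" "0 \<le> b" "x = a - b" using split[of x] by blast
    show ?thesis
    proof (cases "0 \<le> r")
      case True
      have "g (r *\<^sub>R a - r *\<^sub>R b) = f (r *\<^sub>R a) - f (r *\<^sub>R b)"
        using True ab by (intro g_diff scaleR_nonneg_nonneg)
      then show ?thesis using True ab g_diff scale by (simp add: scaleR_diff_right)
    next
      case False
      let ?s = "- r"
      have "g (?s *\<^sub>R b - ?s *\<^sub>R a) = f (?s *\<^sub>R b) - f (?s *\<^sub>R a)"
        using False ab by (intro g_diff scaleR_nonneg_nonneg) simp_all
      also have "\<dots> = ?s *\<^sub>R f b - ?s *\<^sub>R f a" using False ab scale[of ?s] by simp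
      also have "\<dots> = r *\<^sub>R g x" using ab g_diff by (simp add: scaleR_diff_right)
      finally show ?thesis using ab by (simp add: scaleR_diff_right)
    qed
  qed
  have lin: "linear g" by (rule linearI) (rule g_add g_scale)+
  have "order_bounded_op g"
  proof (rule order_bounded_opI)
    fix a b :: 'a
    obtain c where c: "\<And>x. 0 \<le> x \<Longrightarrow> x \<le> b - a \<Longrightarrow> c \<le> ob_apply S x"
      using order_bounded_opE[OF order_bounded_ob_apply[of S]] by metis
    obtain d where d: "\<And>x. 0 \<le> x \<Longrightarrow> x \<le> b - a \<Longrightarrow> ob_apply R x \<le> d"
      using order_bounded_opE[OF order_bounded_ob_apply[of R]] by metis
    have "g a + c \<le> g z \<and> g z \<le> g a + d" if z: "a \<le> z" "z \<le> b" for z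
    proof -
      have pos: "0 \<le> z - a" and le: "z - a \<le> b - a" using z by (simp_all add: diff_right_mono)
      have "g z = g a + f (z - a)" using g_add[of a "z - a"] g_pos[OF pos] by simp
      then show ?thesis
        using c[OF pos le] d[OF pos le] lower[OF pos] upper[OF pos]
        by (auto intro: add_left_mono order_trans)
    qed
    then show "\<exists>c d. \<forall>z. a \<le> z \<and> z \<le> b \<longrightarrow> c \<le> g z \<and> g z \<le> d" by blast
  qed
  with lin have "ob_apply (Abs_ob_op g) = g" by (simp add: Abs_ob_op_inverse)
  then show thesis using that[of "Abs_ob_op g"] g_pos by simp
qed

text \<open>The pointwise supremum is additive because, for \<open>S\<close> and \<open>T\<close> in the family, a common upper bound \<open>U\<close> in
  the family gives \<open>S x + T y \<le> U (x + y)\<close>.\<close>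

lemma directed_supremum_ob_op:
  fixes D :: "'a::dedekind_complete_vector_lattice ob_op set"
  assumes ne: "D \<noteq> {}" and dir: "\<And>S T. S \<in> D \<Longrightarrow> T \<in> D \<Longrightarrow> \<exists>U\<in>D. S \<le> U \<and> T \<le> U"
    and bound: "\<And>T. T \<in> D \<Longrightarrow> T \<le> R"
  obtains V where "\<And>T. T \<in> D \<Longrightarrow> T \<le> V"
    and "\<And>x u. 0 \<le> x \<Longrightarrow> (\<And>T. T \<in> D \<Longrightarrow> ob_apply T x \<le> u) \<Longrightarrow> ob_apply V x \<le> u"
proof -
  define f where "f x = Sup ((\<lambda>T. ob_apply T x) ` D)" for x
  have up: "ob_apply T x \<le> f x" if "T \<in> D" "0 \<le> x" for T x
    unfolding f_def using that ob_apply_le[OF bound]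
    by (intro cSup_upper bdd_aboveI[of _ "ob_apply R x"]) auto
  have least: "f x \<le> u" if "\<And>T. T \<in> D \<Longrightarrow> ob_apply T x \<le> u" for x u
    unfolding f_def using that ne by (intro cSup_least) auto
  obtain T0 where T0: "T0 \<in> D" using ne by blast
  have f_add: "f (x + y) = f x + f y" if x: "0 \<le> x" and y: "0 \<le> y" for x y
  proof (rule antisym)
    show "f (x + y) \<le> f x + f y"
      using up x y by (intro least) (simp add: ob_apply_linear add_mono)
    have "f x \<le> f (x + y) - f y"
    proof (rule least)
      fix S assume S: "S \<in> D"
      have "f y \<le> f (x + y) - ob_apply S x"
      proof (rule least)
        fix T assume T: "T \<in> D"
        obtain U where U: "U \<in> D" "S \<le> U" "T \<le> U" using dir[OF S T] by blast
        have "ob_apply S x + ob_apply T y \<le> ob_apply U x + ob_apply U y"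
          using U x y by (intro add_mono ob_apply_le)
        also have "\<dots> \<le> f (x + y)" using up[OF U(1), of "x + y"] x y by (simp add: ob_apply_linear)
        finally show "ob_apply T y \<le> f (x + y) - ob_apply S x" by (simp only: le_diff_eq add.commute)
      qed
      then show "ob_apply S x \<le> f (x + y) - f y" by (simp only: le_diff_eq add.commute)
    qed
    then show "f x + f y \<le> f (x + y)" by (simp only: le_diff_eq)
  qed
  have f_scale_le: "f (r *\<^sub>R x) \<le> r *\<^sub>R f x" if "0 \<le> r" "0 \<le> x" for r x
    using up that by (intro least) (simp add: ob_apply_linear scaleR_left_mono)
  have f_scale: "f (r *\<^sub>R x) = r *\<^sub>R f x" if r: "0 \<le> r" and x: "0 \<le> x" for r x
  proof (cases "r = 0")
    case True
    then show ?thesis using f_add[of 0 0] by simp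
  next
    case False
    have "f x \<le> inverse r *\<^sub>R f (r *\<^sub>R x)"
      using f_scale_le[of "inverse r" "r *\<^sub>R x"] False r x scaleR_nonneg_nonneg[OF r x] by simp
    then have "r *\<^sub>R f x \<le> f (r *\<^sub>R x)"
      using scaleR_left_mono[of "f x" "inverse r *\<^sub>R f (r *\<^sub>R x)" r] False r by simp
    with f_scale_le[OF r x] show ?thesis by (rule antisym)
  qed
  obtain V where V: "\<And>x. 0 \<le> x \<Longrightarrow> ob_apply V x = f x"
  proof (rule ob_op_extension[of f T0 R])
    show "f x \<le> ob_apply R x" if "0 \<le> x" for x using ob_apply_le[OF bound that] by (rule least)
  qed (use f_add f_scale up T0 in auto)
  show thesis
  proof (rule that[of V])
    show "T \<le> V" if "T \<in> D" for T
      using up[OF that] V by (simp add: less_eq_ob_op.rep_eq)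
    show "ob_apply V x \<le> u" if "0 \<le> x" "\<And>T. T \<in> D \<Longrightarrow> ob_apply T x \<le> u" for x u
      using least[OF that(2)] V[OF that(1)] by simp
  qed
qed

text \<open>The eventual bounds \<open>W\<close> of \<open>\<bar>U\<^sub>i\<bar>\<close> are directed downwards, so their infimum in the space of operators,
  which is \<open>0\<close>, is computed pointwise. In the proof \<open>-V\<close> is this infimum.\<close>

lemma order_null_ob_apply:
  fixes U :: "'i \<Rightarrow> 'a::dedekind_complete_vector_lattice ob_op"
  assumes null: "order_null F U" and x: "0 \<le> x"
  shows "order_null F (\<lambda>i. ob_apply (U i) x)"
proof (cases "F = bot")
  case True
  then show ?thesis by (simp add: order_null_bot)
next
  case False
  let ?D = "{W. \<forall>\<^sub>F i in F. \<bar>U i\<bar> \<le> W}"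
  have nonneg: "0 \<le> W" if W: "W \<in> ?D" for W
  proof -
    obtain i where "\<bar>U i\<bar> \<le> W" using W eventually_happens'[OF False] by blast
    then show ?thesis by (meson abs_ge_zero order_trans)
  qed
  obtain W0 where W0: "W0 \<in> ?D" using order_null_bound[OF null] by blast
  obtain V where V: "\<And>T. T \<in> uminus ` ?D \<Longrightarrow> T \<le> V"
    and V_least: "\<And>x u. 0 \<le> x \<Longrightarrow> (\<And>T. T \<in> uminus ` ?D \<Longrightarrow> ob_apply T x \<le> u) \<Longrightarrow> ob_apply V x \<le> u"
  proof (rule directed_supremum_ob_op[of "uminus ` ?D" 0])
    fix S T assume "S \<in> uminus ` ?D" "T \<in> uminus ` ?D"
    then obtain P Q where PQ: "P \<in> ?D" "Q \<in> ?D" and ST: "S = - P" "T = - Q" by blast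
    have "inf P Q \<in> ?D" using PQ by (auto intro: eventually_conj)
    then show "\<exists>U\<in>uminus ` ?D. S \<le> U \<and> T \<le> U"
      by (intro bexI[of _ "- inf P Q"]) (simp_all add: ST)
  next
    fix T assume "T \<in> uminus ` ?D"
    then obtain W where "W \<in> ?D" "T = - W" by blast
    then show "T \<le> 0" using nonneg[of W] by simp
  qed (use W0 in blast)+
  have "- V \<le> 0"
  proof (rule order_nullD[OF null])
    fix W assume "\<forall>\<^sub>F i in F. \<bar>U i\<bar> \<le> W"
    then have "- W \<le> V" by (intro V) blast
    then show "- V \<le> W" by (simp add: minus_le_iff)
  qed
  then have "0 \<le> ob_apply V x" using x ob_apply_nonneg by simp
  have up: "\<forall>\<^sub>F i in F. \<bar>ob_apply (U i) x\<bar> \<le> ob_apply W x" if "W \<in> ?D" for W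
  proof -
    have "\<forall>\<^sub>F i in F. \<bar>U i\<bar> \<le> W" using that by simp
    then show ?thesis
    proof eventually_elim
      case (elim i)
      have "\<bar>ob_apply (U i) x\<bar> \<le> ob_apply \<bar>U i\<bar> \<bar>x\<bar>"
        by (rule abs_ob_apply_le) (rule abs_ge_self abs_ge_minus_self)+
      also have "\<dots> \<le> ob_apply W x" using ob_apply_le[OF elim x] x by (simp add: abs_of_nonneg)
      finally show ?case .
    qed
  qed
  show ?thesis
  proof (rule order_nullI[OF up[OF W0]])
    fix z assume z: "\<And>w. \<forall>\<^sub>F i in F. \<bar>ob_apply (U i) x\<bar> \<le> w \<Longrightarrow> z \<le> w"
    have "ob_apply V x \<le> - z"
      by (rule V_least[OF x]) (use z[OF up] in auto)
    with \<open>0 \<le> ob_apply V x\<close> have "0 \<le> - z" by (rule order_trans)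
    then show "z \<le> 0" by simp
  qed
qed

section \<open>Null families of orthomorphisms\<close>

lift_definition id_ob_op :: "'a::vector_lattice ob_op" is "\<lambda>x. x"
  by (auto intro!: order_bounded_opI linearI)

lemma id_ob_op_apply [simp]: "ob_apply id_ob_op x = x"
  by (simp add: id_ob_op.rep_eq)

lemma Orth_id: "id_ob_op \<in> Orth"
  by (auto simp: Orth_def)

lemma id_ob_op_nonneg: "0 \<le> id_ob_op"
  by (simp add: less_eq_ob_op.rep_eq)

text \<open>If \<open>A\<^sub>i\<close> is multiplication by a function \<open>a\<^sub>i\<close>, the family in question is \<open>x min \<bar>a\<^sub>i\<bar> 1\<close>. In contrast to
  strong unbounded order convergence, \<open>A\<^sub>i x\<close> is tested only against \<open>x\<close> itself. For orthomorphisms the lemmas below show that this is equivalent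
  both to unbounded order convergence to zero and to strong unbounded order convergence to zero.\<close>

definition orth_null :: "'i filter \<Rightarrow> ('i \<Rightarrow> 'a::vector_lattice ob_op) \<Rightarrow> bool" where
  "orth_null F A \<longleftrightarrow> (\<forall>x\<ge>0. order_null F (\<lambda>i. inf \<bar>ob_apply (A i) x\<bar> x))"

lemma uo_null_imp_orth_null:
  fixes A :: "'i \<Rightarrow> 'a::dedekind_complete_vector_lattice ob_op"
  assumes orth: "\<forall>\<^sub>F i in F. A i \<in> Orth" and null: "order_null F (\<lambda>i. inf \<bar>A i\<bar> id_ob_op)"
  shows "orth_null F A"
  unfolding orth_null_def
proof (intro allI impI)
  fix x :: 'a assume x: "0 \<le> x"
  show "order_null F (\<lambda>i. inf \<bar>ob_apply (A i) x\<bar> x)"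
  proof (rule order_null_mono[OF order_null_ob_apply[OF null x]])
    show "\<forall>\<^sub>F i in F. \<bar>inf \<bar>ob_apply (A i) x\<bar> x\<bar> \<le> \<bar>ob_apply (inf \<bar>A i\<bar> id_ob_op) x\<bar>"
      using orth
    proof eventually_elim
      case (elim i)
      show ?case
        using ob_apply_abs_Orth[OF elim, of x] ob_apply_inf_Orth[OF Orth_abs[OF elim] Orth_id x] x
        by (simp add: abs_of_nonneg)
    qed
  qed
qed

text \<open>Let \<open>z\<close> be a lower bound of the eventual bounds of \<open>\<bar>A\<^sub>i x\<bar> \<and> y\<close> and \<open>u = z\<^sup>+\<close>. The inequality
  \<open>\<bar>A\<^sub>i x\<bar> \<and> y \<le> n (\<bar>A\<^sub>i x\<bar> \<and> x) + (y - n x)\<^sup>+\<close> gives \<open>u \<le> (y - n x)\<^sup>+\<close> for all \<open>n\<close>, so \<open>u\<close> is disjoint from \<open>x\<close>.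
  Since orthomorphisms preserve disjointness, \<open>u\<close> is then also disjoint from the supremum of the
  \<open>\<bar>A x\<bar> \<and> y\<close> over all orthomorphisms \<open>A\<close>, below which it lies.\<close>

lemma orth_null_imp_order_null:
  fixes A :: "'i \<Rightarrow> 'a::dedekind_complete_vector_lattice ob_op"
  assumes orth: "\<forall>\<^sub>F i in F. A i \<in> Orth" and null: "orth_null F A" and y: "0 \<le> y"
  shows "order_null F (\<lambda>i. inf \<bar>ob_apply (A i) x\<bar> y)"
proof -
  have pos: "order_null F (\<lambda>i. inf \<bar>ob_apply (A i) x\<bar> y)" if x: "0 \<le> x" for x
  proof -
    let ?f = "\<lambda>T. inf \<bar>ob_apply T x\<bar> y"
    have f_abs: "\<bar>?f T\<bar> = ?f T" for T using y by (simp add: abs_of_nonneg)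
    have null': "order_null F (\<lambda>i. inf \<bar>ob_apply (A i) x\<bar> x)"
      using null x unfolding orth_null_def by blast
    show ?thesis
    proof (rule order_nullI[where w = y])
      show "\<forall>\<^sub>F i in F. \<bar>?f (A i)\<bar> \<le> y" unfolding f_abs by simp
      fix z assume z: "\<And>w. \<forall>\<^sub>F i in F. \<bar>?f (A i)\<bar> \<le> w \<Longrightarrow> z \<le> w"
      let ?u = "sup z 0"
      have "z \<le> sup (y - real n *\<^sub>R x) 0" for n
      proof (cases n)
        case 0
        have "z \<le> y" by (rule z) (simp add: f_abs)
        then show ?thesis using 0 by (simp add: le_supI1)
      next
        case (Suc m)
        let ?r = "real n" and ?c = "sup (y - real n *\<^sub>R x) 0"
        have r: "1 \<le> ?r" using Suc by simp
        have "inverse ?r *\<^sub>R (z - ?c) \<le> 0"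
        proof (rule order_nullD[OF null'])
          fix w assume "\<forall>\<^sub>F i in F. \<bar>inf \<bar>ob_apply (A i) x\<bar> x\<bar> \<le> w"
          then have "\<forall>\<^sub>F i in F. \<bar>?f (A i)\<bar> \<le> ?c + ?r *\<^sub>R w"
          proof eventually_elim
            case (elim i)
            let ?a = "\<bar>ob_apply (A i) x\<bar>"
            have "?f (A i) \<le> inf ?a (?c + ?r *\<^sub>R x)"
              by (intro inf_mono order_refl) (simp add: add_sup_distrib_right)
            also have "\<dots> \<le> inf ?a ?c + inf ?a (?r *\<^sub>R x)"
              using inf_add_le[of ?c "?r *\<^sub>R x" ?a] scaleR_nonneg_nonneg[of ?r x] x
              by (simp add: inf_commute)
            also have "\<dots> \<le> ?c + ?r *\<^sub>R inf ?a x"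
              using r x by (intro add_mono inf_scaleR_le) simp_all
            also have "\<dots> \<le> ?c + ?r *\<^sub>R w"
              using elim x by (intro add_left_mono scaleR_left_mono) (simp_all add: abs_of_nonneg)
            finally show ?case unfolding f_abs .
          qed
          from z[OF this] have "z - ?c \<le> ?r *\<^sub>R w" by (simp only: diff_le_eq add.commute)
          then have "inverse ?r *\<^sub>R (z - ?c) \<le> inverse ?r *\<^sub>R (?r *\<^sub>R w)"
            by (rule scaleR_left_mono) simp
          then show "inverse ?r *\<^sub>R (z - ?c) \<le> w" using r by simp
        qed
        then have "?r *\<^sub>R (inverse ?r *\<^sub>R (z - ?c)) \<le> ?r *\<^sub>R 0" by (rule scaleR_left_mono) simp
        then have "z - ?c \<le> 0" using r by simp
        then show ?thesis by (simp only: diff_le_eq add_0)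
      qed
      then have "inf ?u x = 0" using x y by (intro inf_eq_zero_if_le_excess[of _ _ y]) simp_all
      then have x_u: "x \<in> disjoint_complement ?u"
        using x by (simp add: disjoint_complement_iff abs_of_nonneg inf_commute)
      let ?s = "Sup (?f ` Orth)"
      have bdd: "bdd_above (?f ` Orth)" by (rule bdd_aboveI[of _ y]) auto
      have Orth0: "(0 :: 'a ob_op) \<in> Orth" by (rule subspace_0[OF subspace_Orth])
      have "is_supremum (?f ` Orth) ?s"
        unfolding is_supremum_def using cSup_upper[OF _ bdd] Orth0
        by (auto intro!: cSup_least)
      moreover have "?f ` Orth \<subseteq> disjoint_complement ?u"
      proof clarify
        fix T :: "'a ob_op" assume "T \<in> Orth"
        then have "ob_apply T x \<in> disjoint_complement ?u" using x_u by (rule Orth_disjoint)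
        then show "?f T \<in> disjoint_complement ?u"
          by (rule disjoint_complement_solid) (simp only: f_abs inf_le1)
      qed
      ultimately have s_u: "?s \<in> disjoint_complement ?u"
        using band_disjoint_complement unfolding band_def by blast
      have "0 \<le> ?s" using cSup_upper[OF imageI[OF Orth0, of ?f] bdd] y by (simp add: inf_absorb1)
      have "\<forall>\<^sub>F i in F. \<bar>?f (A i)\<bar> \<le> ?s"
        using orth by eventually_elim (simp only: f_abs, rule cSup_upper[OF _ bdd], blast)
      from z[OF this] have "?u \<le> ?s" using \<open>0 \<le> ?s\<close> by simp
      with s_u \<open>0 \<le> ?s\<close> have "?u \<le> 0"
        by (simp add: disjoint_complement_iff abs_of_nonneg inf_absorb2)
      then show "z \<le> 0" by simp
    qed
  qed
  show ?thesis
  proof (rule order_null_mono[OF pos[of "\<bar>x\<bar>"]])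
    show "\<forall>\<^sub>F i in F. \<bar>inf \<bar>ob_apply (A i) x\<bar> y\<bar> \<le> \<bar>inf \<bar>ob_apply (A i) \<bar>x\<bar>\<bar> y\<bar>"
      using orth
    proof eventually_elim
      case (elim i)
      show ?case using ob_apply_abs_Orth[OF elim, of x] ob_apply_abs_Orth[OF elim, of "\<bar>x\<bar>"] by simp
    qed
  qed simp
qed

text \<open>Let \<open>Z\<close> be a lower bound of the eventual bounds of \<open>\<bar>A\<^sub>i\<bar> \<and> R\<close>, and \<open>w\<close> an eventual bound of
  \<open>\<bar>A\<^sub>i x\<bar> \<and> R x\<close>, which dominates \<open>(\<bar>A\<^sub>i\<bar> \<and> R) x\<close>, for a fixed \<open>x\<close>. The orthomorphisms \<open>U \<le> R\<close> with \<open>U x \<le> w\<close> form a set closed under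
  suprema of pairs; its supremum is an eventual bound whose value at \<open>x\<close> is still at most \<open>w\<close>. Hence
  \<open>Z x \<le> w\<close>.\<close>

lemma orth_null_imp_uo_null:
  fixes A :: "'i \<Rightarrow> 'a::dedekind_complete_vector_lattice ob_op"
  assumes orth: "\<forall>\<^sub>F i in F. A i \<in> Orth" and null: "orth_null F A" and R: "0 \<le> R"
  shows "order_null F (\<lambda>i. inf \<bar>A i\<bar> R)"
proof (cases "F = bot")
  case True
  then show ?thesis by (simp add: order_null_bot)
next
  case nontrivial: False
  show ?thesis
  proof (rule order_nullI[where w = R])
    let ?U = "\<lambda>i. inf \<bar>A i\<bar> R"
    have U_abs: "\<bar>?U i\<bar> = ?U i" for i using R by (simp add: abs_of_nonneg)
    have U_Orth: "\<forall>\<^sub>F i in F. ?U i \<in> Orth"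
      using orth
    proof eventually_elim
      case (elim i)
      have "- ?U i \<le> \<bar>A i\<bar>"
        using R by (meson abs_ge_zero inf_greatest neg_le_0_iff_le order_trans)
      then show ?case by (intro Orth_dominated[OF Orth_abs[OF elim]]) simp_all
    qed
    show "\<forall>\<^sub>F i in F. \<bar>?U i\<bar> \<le> R" unfolding U_abs by simp
    fix Z assume Z: "\<And>W. \<forall>\<^sub>F i in F. \<bar>?U i\<bar> \<le> W \<Longrightarrow> Z \<le> W"
    have "ob_apply Z x \<le> 0" if x: "0 \<le> x" for x
    proof -
      have "order_null F (\<lambda>i. inf \<bar>ob_apply (A i) x\<bar> (ob_apply R x))"
        by (rule orth_null_imp_order_null[OF orth null ob_apply_nonneg[OF R x]])
      then show ?thesis
      proof (rule order_nullD)
        fix w assume w: "\<forall>\<^sub>F i in F. \<bar>inf \<bar>ob_apply (A i) x\<bar> (ob_apply R x)\<bar> \<le> w"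
        let ?D = "{U \<in> Orth. U \<le> R \<and> ob_apply U x \<le> w}"
        have ev: "\<forall>\<^sub>F i in F. ?U i \<in> ?D"
          using U_Orth orth w
        proof eventually_elim
          case (elim i)
          have "ob_apply (?U i) x \<le> inf \<bar>ob_apply (A i) x\<bar> (ob_apply R x)"
            using ob_apply_le[of "?U i" "\<bar>A i\<bar>" x] ob_apply_le[of "?U i" R x] x
              ob_apply_abs_Orth[OF elim(2), of x] by (simp add: abs_of_nonneg)
          also have "\<dots> \<le> w" using elim(3) by (meson abs_ge_self order_trans)
          finally show ?case using elim(1) by simp
        qed
        obtain V where V: "\<And>T. T \<in> ?D \<Longrightarrow> T \<le> V"
          and least: "\<And>x u. 0 \<le> x \<Longrightarrow> (\<And>T. T \<in> ?D \<Longrightarrow> ob_apply T x \<le> u) \<Longrightarrow> ob_apply V x \<le> u"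
        proof (rule directed_supremum_ob_op[of ?D R])
          fix S T assume "S \<in> ?D" "T \<in> ?D"
          then have "sup S T \<in> ?D" using x by (simp add: Orth_sup ob_apply_sup_Orth)
          then show "\<exists>U\<in>?D. S \<le> U \<and> T \<le> U" by (intro bexI[of _ "sup S T"]) simp_all
        qed (use eventually_happens'[OF nontrivial ev] in blast)+
        have "Z \<le> V" by (rule Z) (use ev in eventually_elim, simp only: U_abs V)
        then have "ob_apply Z x \<le> ob_apply V x" using x by (rule ob_apply_le)
        also have "\<dots> \<le> w" by (rule least[OF x]) simp
        finally show "ob_apply Z x \<le> w" .
      qed
    qed
    then show "Z \<le> 0" by (simp add: less_eq_ob_op.rep_eq)
  qed
qed

section \<open>Sums and products of null families\<close>

lemma orth_null_le_sum:
  fixes A B C :: "'i \<Rightarrow> 'a::vector_lattice ob_op"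
  assumes A: "orth_null F A" and B: "orth_null F B"
    and le: "\<forall>\<^sub>F i in F. \<forall>x\<ge>0. inf \<bar>ob_apply (C i) x\<bar> x
      \<le> inf \<bar>ob_apply (A i) x\<bar> x + inf \<bar>ob_apply (B i) x\<bar> x"
  shows "orth_null F C"
  unfolding orth_null_def
proof (intro allI impI)
  fix x :: 'a assume x: "0 \<le> x"
  have "order_null F (\<lambda>i. inf \<bar>ob_apply (A i) x\<bar> x)" "order_null F (\<lambda>i. inf \<bar>ob_apply (B i) x\<bar> x)"
    using A B x unfolding orth_null_def by blast+
  from order_null_add[OF this] show "order_null F (\<lambda>i. inf \<bar>ob_apply (C i) x\<bar> x)"
  proof (rule order_null_mono)
    show "\<forall>\<^sub>F i in F. \<bar>inf \<bar>ob_apply (C i) x\<bar> x\<bar>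
      \<le> \<bar>inf \<bar>ob_apply (A i) x\<bar> x + inf \<bar>ob_apply (B i) x\<bar> x\<bar>"
      using le by eventually_elim (use x in \<open>simp add: abs_of_nonneg\<close>)
  qed
qed

lemma orth_null_abs_le_sum:
  fixes A B C :: "'i \<Rightarrow> 'a::vector_lattice ob_op"
  assumes A: "orth_null F A" and B: "orth_null F B"
    and le: "\<forall>\<^sub>F i in F. \<forall>x\<ge>0. \<bar>ob_apply (C i) x\<bar>
      \<le> \<bar>ob_apply (A i) x\<bar> + \<bar>ob_apply (B i) x\<bar>"
  shows "orth_null F C"
  using A B
proof (rule orth_null_le_sum)
  show "\<forall>\<^sub>F i in F. \<forall>x\<ge>0. inf \<bar>ob_apply (C i) x\<bar> x
      \<le> inf \<bar>ob_apply (A i) x\<bar> x + inf \<bar>ob_apply (B i) x\<bar> x"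
    using le
  proof eventually_elim
    case (elim i)
    show ?case
    proof (intro allI impI)
      fix x :: 'a assume x: "0 \<le> x"
      then have "inf \<bar>ob_apply (C i) x\<bar> x \<le> inf (\<bar>ob_apply (A i) x\<bar> + \<bar>ob_apply (B i) x\<bar>) x"
        using elim by (intro inf_mono order_refl) blast
      also have "\<dots> \<le> inf \<bar>ob_apply (A i) x\<bar> x + inf \<bar>ob_apply (B i) x\<bar> x"
        using x by (intro inf_add_le) simp_all
      finally show "inf \<bar>ob_apply (C i) x\<bar> x \<le> inf \<bar>ob_apply (A i) x\<bar> x + inf \<bar>ob_apply (B i) x\<bar> x" .
    qed
  qed
qed

lemma orth_null_const_0: "orth_null F (\<lambda>i. 0)"
  unfolding orth_null_def
proof (intro allI impI)
  fix x :: 'b assume "0 \<le> x"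
  then have "\<bar>inf \<bar>ob_apply 0 x\<bar> x\<bar> = 0" by (simp add: inf_absorb1)
  then show "order_null F (\<lambda>i. inf \<bar>ob_apply 0 x\<bar> x)"
    by (intro order_nullI[where w = 0]) auto
qed

text \<open>For functions this says \<open>min (p q) 1 \<le> min p 1 + min q 1\<close>: if \<open>p \<le> 1\<close> then \<open>p q \<le> q\<close>, and otherwise
  the right-hand side is at least \<open>1\<close>. The case distinction becomes the disjointness of \<open>(P q - q)\<^sup>+\<close> and
  \<open>(x - P x)\<^sup>+\<close>.\<close>

lemma Orth_mult_inf_le:
  fixes P Q :: "'a::dedekind_complete_vector_lattice ob_op"
  assumes P: "P \<in> Orth" and x: "0 \<le> x"
  shows "inf \<bar>ob_apply (P * Q) x\<bar> x \<le> inf \<bar>ob_apply P x\<bar> x + inf \<bar>ob_apply Q x\<bar> x"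
proof -
  define q where "q = \<bar>ob_apply Q x\<bar>"
  have q: "0 \<le> q" by (simp add: q_def)
  define M where "M = \<bar>P\<bar> - id_ob_op"
  have M: "M \<in> Orth" "- M \<in> Orth"
    using Orth_abs[OF P] Orth_id by (auto simp: M_def intro: subspace_diff[OF subspace_Orth])
  have M_pos: "0 \<le> ob_pos M" "0 \<le> ob_pos (- M)"
    using is_supremum_ob_pos unfolding is_supremum_def by blast+
  have qx: "0 \<le> q + x" using q x by simp
  have "ob_apply (ob_pos M) q \<le> ob_apply (ob_pos M) (q + x)"
    "ob_apply (ob_pos (- M)) x \<le> ob_apply (ob_pos (- M)) (q + x)"
    using M_pos q x by (intro ob_apply_mono; simp)+
  then have "inf (sup (ob_apply M q) 0) (sup (- ob_apply M x) 0)
      \<le> inf (sup (ob_apply M (q + x)) 0) (sup (- ob_apply M (q + x)) 0)"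
    using ob_apply_ob_pos_Orth[OF M(1)] ob_apply_ob_pos_Orth[OF M(2)] q x qx
    by (intro inf_mono) (simp_all del: ob_apply_linear)
  also have "\<dots> = 0"
    using inf_pprt_nprt[of "ob_apply M (q + x)"] by (simp add: pprt_def flip: pprt_neg)
  finally have disj: "inf (sup (ob_apply M q) 0) (sup (- ob_apply M x) 0) \<le> 0" .
  have Mq: "ob_apply M q = ob_apply \<bar>P\<bar> q - q" and Mx: "ob_apply M x = \<bar>ob_apply P x\<bar> - x"
    using ob_apply_abs_Orth[OF P, of x] x by (simp_all add: M_def abs_of_nonneg)
  let ?e = "sup (ob_apply M q) 0"
  have "inf ?e x + sup (- ob_apply M x) 0 \<le> x"
  proof (rule disjoint_add_le)
    show "inf (inf ?e x) (sup (- ob_apply M x) 0) \<le> 0"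
      using disj by (meson inf_le1 inf_mono order_refl order_trans)
    show "sup (- ob_apply M x) 0 \<le> x" using x by (simp add: Mx)
  qed (use x in simp_all)
  then have "inf ?e x \<le> x - sup (- ob_apply M x) 0" by (simp only: le_diff_eq)
  also have "\<dots> = inf \<bar>ob_apply P x\<bar> x"
    by (simp only: Mx diff_sup_eq_inf add_inf_distrib_left) simp
  finally have e: "inf ?e x \<le> inf \<bar>ob_apply P x\<bar> x" .
  have "\<bar>ob_apply (P * Q) x\<bar> = ob_apply \<bar>P\<bar> q"
    using ob_apply_abs_Orth[OF P, of "ob_apply Q x"] by (simp add: q_def)
  also have "\<dots> \<le> ?e + q" by (simp add: Mq add_sup_distrib_right)
  finally have "inf \<bar>ob_apply (P * Q) x\<bar> x \<le> inf (?e + q) x" by (intro inf_mono order_refl)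
  also have "\<dots> \<le> inf ?e x + inf q x" using q x by (intro inf_add_le) simp_all
  also have "\<dots> \<le> inf \<bar>ob_apply P x\<bar> x + inf q x" using e by (rule add_right_mono)
  finally show ?thesis by (simp add: q_def)
qed

lemma orth_null_mult:
  fixes A B :: "'i \<Rightarrow> 'a::dedekind_complete_vector_lattice ob_op"
  assumes "\<forall>\<^sub>F i in F. A i \<in> Orth" and A: "orth_null F A" and B: "orth_null F B"
  shows "orth_null F (\<lambda>i. A i * B i)"
  using A B
proof (rule orth_null_le_sum)
  show "\<forall>\<^sub>F i in F. \<forall>x\<ge>0. inf \<bar>ob_apply (A i * B i) x\<bar> x
      \<le> inf \<bar>ob_apply (A i) x\<bar> x + inf \<bar>ob_apply (B i) x\<bar> x"
    using assms(1) by eventually_elim (blast intro: Orth_mult_inf_le)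
qed

text \<open>Strong unbounded convergence of \<open>A\<^sub>i\<close> is convergence at every point, and in particular at \<open>R x\<close>.\<close>

lemma orth_null_mult_right:
  fixes A :: "'i \<Rightarrow> 'a::dedekind_complete_vector_lattice ob_op"
  assumes "\<forall>\<^sub>F i in F. A i \<in> Orth" "orth_null F A"
  shows "orth_null F (\<lambda>i. A i * R)"
  using orth_null_imp_order_null[OF assms] unfolding orth_null_def by simp

text \<open>The estimate of a product, applied to \<open>R A = (R / n) (n A)\<close>, bounds \<open>\<bar>R A x\<bar> \<and> x\<close> by
  \<open>\<bar>R x\<bar> / n + n (\<bar>A x\<bar> \<and> x)\<close>, whose first term is arbitrarily small.\<close>

lemma orth_null_mult_left:
  fixes A :: "'i \<Rightarrow> 'a::dedekind_complete_vector_lattice ob_op"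
  assumes R: "R \<in> Orth" and A: "orth_null F A"
  shows "orth_null F (\<lambda>i. R * A i)"
  unfolding orth_null_def
proof (intro allI impI)
  fix x :: 'a assume x: "0 \<le> x"
  let ?g = "\<lambda>i. inf \<bar>ob_apply (A i) x\<bar> x"
  have g: "order_null F ?g" using A x unfolding orth_null_def by blast
  have "\<bar>inf \<bar>ob_apply (R * A i) x\<bar> x\<bar>
      \<le> real (Suc n) *\<^sub>R \<bar>?g i\<bar> + inverse (real (Suc n)) *\<^sub>R \<bar>ob_apply R x\<bar>" for n i
  proof -
    let ?n = "real (Suc n)"
    have n: "1 \<le> ?n" "0 \<le> inverse ?n" by simp_all
    have "inf \<bar>ob_apply (R * A i) x\<bar> x = inf \<bar>ob_apply ((inverse ?n *\<^sub>R R) * (?n *\<^sub>R A i)) x\<bar> x"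
      by (simp add: ob_apply_linear del: of_nat_Suc)
    also have "\<dots> \<le> inf \<bar>ob_apply (inverse ?n *\<^sub>R R) x\<bar> x + inf \<bar>ob_apply (?n *\<^sub>R A i) x\<bar> x"
      using subspace_scale[OF subspace_Orth R] x by (rule Orth_mult_inf_le)
    also have "\<dots> \<le> inverse ?n *\<^sub>R \<bar>ob_apply R x\<bar> + ?n *\<^sub>R ?g i"
    proof (rule add_mono)
      show "inf \<bar>ob_apply (inverse ?n *\<^sub>R R) x\<bar> x \<le> inverse ?n *\<^sub>R \<bar>ob_apply R x\<bar>"
        using abs_scaleR_le[of "inverse ?n" "ob_apply R x"] n(2)
        by (simp add: le_infI1 del: of_nat_Suc)
      have "inf \<bar>ob_apply (?n *\<^sub>R A i) x\<bar> x \<le> inf x (?n *\<^sub>R \<bar>ob_apply (A i) x\<bar>)"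
        using abs_scaleR_le[of ?n "ob_apply (A i) x"] n(1)
        by (simp add: le_infI1 del: of_nat_Suc)
      also have "\<dots> \<le> ?n *\<^sub>R inf x \<bar>ob_apply (A i) x\<bar>"
        using n(1) x by (intro inf_scaleR_le) simp_all
      finally show "inf \<bar>ob_apply (?n *\<^sub>R A i) x\<bar> x \<le> ?n *\<^sub>R ?g i" by (simp only: inf_commute)
    qed
    finally show ?thesis using x by (simp only: abs_of_nonneg le_inf_iff abs_ge_zero simp_thms add.commute)
  qed
  then show "order_null F (\<lambda>i. inf \<bar>ob_apply (R * A i) x\<bar> x)"
    by (intro order_null_approx[OF g]) (rule always_eventually, blast)
qed

section \<open>Limits of orthomorphisms\<close>

text \<open>The elements \<open>\<bar>f\<^sub>i\<bar> \<and> \<bar>l\<bar>\<close> belong to the band, hence so does the supremum of all \<open>\<bar>a\<bar> \<and> \<bar>l\<bar>\<close> with \<open>a\<close> in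
  the band. It is at most \<open>\<bar>l\<bar>\<close>, and differs from it by at most every eventual bound of \<open>\<bar>f\<^sub>i - l\<bar> \<and> \<bar>l\<bar>\<close>.\<close>

lemma band_limit:
  fixes f :: "'i \<Rightarrow> 'a::dedekind_complete_vector_lattice"
  assumes B: "band B" and F: "F \<noteq> bot" and f: "\<forall>\<^sub>F i in F. f i \<in> B"
    and null: "order_null F (\<lambda>i. inf \<bar>f i - l\<bar> \<bar>l\<bar>)"
  shows "l \<in> B"
proof -
  have sub: "subspace B" and solid: "\<And>x y. y \<in> B \<Longrightarrow> \<bar>x\<bar> \<le> \<bar>y\<bar> \<Longrightarrow> x \<in> B"
    and sup: "\<And>D s. D \<subseteq> B \<Longrightarrow> is_supremum D s \<Longrightarrow> s \<in> B"
    using B unfolding band_def order_ideal_def by blast+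
  let ?D = "(\<lambda>a. inf \<bar>a\<bar> \<bar>l\<bar>) ` B"
  have bdd: "bdd_above ?D" by (rule bdd_aboveI[of _ "\<bar>l\<bar>"]) auto
  have "is_supremum ?D (Sup ?D)"
    unfolding is_supremum_def using cSup_upper[OF _ bdd] subspace_0[OF sub]
    by (auto intro!: cSup_least)
  moreover have "?D \<subseteq> B"
  proof clarify
    fix a assume "a \<in> B"
    then show "inf \<bar>a\<bar> \<bar>l\<bar> \<in> B" by (rule solid) (simp add: abs_of_nonneg)
  qed
  ultimately have s: "Sup ?D \<in> B" by (intro sup)
  have "\<bar>l\<bar> - Sup ?D \<le> 0"
  proof (rule order_nullD[OF null])
    fix w assume "\<forall>\<^sub>F i in F. \<bar>inf \<bar>f i - l\<bar> \<bar>l\<bar>\<bar> \<le> w"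
    with f have "\<forall>\<^sub>F i in F. f i \<in> B \<and> \<bar>inf \<bar>f i - l\<bar> \<bar>l\<bar>\<bar> \<le> w" by (rule eventually_conj)
    then obtain i where i: "f i \<in> B" "\<bar>inf \<bar>f i - l\<bar> \<bar>l\<bar>\<bar> \<le> w"
      using eventually_happens'[OF F] by blast
    have "\<bar>l\<bar> - Sup ?D \<le> \<bar>l\<bar> - inf \<bar>f i\<bar> \<bar>l\<bar>"
      using cSup_upper[OF imageI[OF i(1)] bdd] by (rule diff_left_mono)
    also have "\<dots> \<le> inf \<bar>f i - l\<bar> \<bar>l\<bar>" by (rule abs_minus_inf_le)
    finally have "\<bar>l\<bar> - Sup ?D \<le> inf \<bar>f i - l\<bar> \<bar>l\<bar>" .
    then show "\<bar>l\<bar> - Sup ?D \<le> w" using i(2) by (meson abs_ge_self order_trans)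
  qed
  then have "\<bar>l\<bar> \<le> \<bar>Sup ?D\<bar>" by (meson abs_ge_self diff_le_0_iff_le order_trans)
  with s show ?thesis by (rule solid)
qed

lemma Orth_apply_band: "T \<in> Orth \<Longrightarrow> band B \<Longrightarrow> x \<in> B \<Longrightarrow> ob_apply T x \<in> B"
  unfolding Orth_def by blast

lemma suo_limit_Orth:
  fixes T :: "'i \<Rightarrow> 'a::dedekind_complete_vector_lattice ob_op"
  assumes F: "F \<noteq> bot" and T: "\<forall>\<^sub>F i in F. T i \<in> Orth"
    and null: "\<And>x. order_null F (\<lambda>i. inf \<bar>ob_apply (T i) x - ob_apply L x\<bar> \<bar>ob_apply L x\<bar>)"
  shows "L \<in> Orth"
  unfolding Orth_def
proof clarify
  fix B :: "'a set" and x assume B: "band B" and x: "x \<in> B"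
  have "\<forall>\<^sub>F i in F. ob_apply (T i) x \<in> B"
    using T by eventually_elim (rule Orth_apply_band[OF _ B x])
  then show "ob_apply L x \<in> B" using null by (rule band_limit[OF B F])
qed

text \<open>For \<open>x\<close> in a band, the elements \<open>(\<bar>T\<^sub>i\<bar> \<and> \<bar>L\<bar>) \<bar>x\<bar>\<close> of the band converge in order to \<open>\<bar>L\<bar> \<bar>x\<bar>\<close>, which
  dominates \<open>\<bar>L x\<bar>\<close>.\<close>

lemma uo_limit_Orth:
  fixes T :: "'i \<Rightarrow> 'a::dedekind_complete_vector_lattice ob_op"
  assumes F: "F \<noteq> bot" and T: "\<forall>\<^sub>F i in F. T i \<in> Orth"
    and null: "order_null F (\<lambda>i. inf \<bar>T i - L\<bar> \<bar>L\<bar>)"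
  shows "L \<in> Orth"
  unfolding Orth_def
proof clarify
  fix B :: "'a set" and x assume B: "band B" and x: "x \<in> B"
  have solid: "\<And>x y. y \<in> B \<Longrightarrow> \<bar>x\<bar> \<le> \<bar>y\<bar> \<Longrightarrow> x \<in> B"
    using B unfolding band_def order_ideal_def by blast
  have xB: "\<bar>x\<bar> \<in> B" by (rule solid[OF x]) simp
  let ?f = "\<lambda>i. ob_apply (inf \<bar>T i\<bar> \<bar>L\<bar>) \<bar>x\<bar>" and ?l = "ob_apply \<bar>L\<bar> \<bar>x\<bar>"
  have "?l \<in> B"
  proof (rule band_limit[OF B F])
    show "\<forall>\<^sub>F i in F. ?f i \<in> B"
      using T
    proof eventually_elim
      case (elim i)
      have "- inf \<bar>T i\<bar> \<bar>L\<bar> \<le> 0" by simp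
      also have "0 \<le> \<bar>T i\<bar>" by simp
      finally have "inf \<bar>T i\<bar> \<bar>L\<bar> \<in> Orth"
        by (intro Orth_dominated[OF Orth_abs[OF elim]] inf_le1)
      then show ?case by (rule Orth_apply_band[OF _ B xB])
    qed
    show "order_null F (\<lambda>i. inf \<bar>?f i - ?l\<bar> \<bar>?l\<bar>)"
    proof (rule order_null_mono[OF order_null_ob_apply[OF null, of "\<bar>x\<bar>"]])
      show "\<forall>\<^sub>F i in F. \<bar>inf \<bar>?f i - ?l\<bar> \<bar>?l\<bar>\<bar> \<le> \<bar>ob_apply (inf \<bar>T i - L\<bar> \<bar>L\<bar>) \<bar>x\<bar>\<bar>"
      proof (rule always_eventually, rule allI)
        fix i
        let ?D = "inf \<bar>T i\<bar> \<bar>L\<bar> - \<bar>L\<bar>" and ?V = "inf \<bar>T i - L\<bar> \<bar>L\<bar>"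
        have "- ?D \<le> ?V" using abs_minus_inf_le[of L "T i"] by simp
        moreover have "?D \<le> 0" by simp
        then have "?D \<le> ?V" by (rule order_trans) simp
        ultimately have "\<bar>ob_apply ?D \<bar>x\<bar>\<bar> \<le> ob_apply ?V \<bar>\<bar>x\<bar>\<bar>" by (intro abs_ob_apply_le)
        then have "\<bar>?f i - ?l\<bar> \<le> \<bar>ob_apply ?V \<bar>x\<bar>\<bar>"
          by (simp add: order_trans[OF _ abs_ge_self])
        then show "\<bar>inf \<bar>?f i - ?l\<bar> \<bar>?l\<bar>\<bar> \<le> \<bar>ob_apply ?V \<bar>x\<bar>\<bar>"
          by (simp add: abs_of_nonneg le_infI1)
      qed
    qed simp
  qed
  moreover have "\<bar>ob_apply L x\<bar> \<le> ?l" by (rule abs_ob_apply_le) (rule abs_ge_self abs_ge_minus_self)+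
  then have "\<bar>ob_apply L x\<bar> \<le> \<bar>?l\<bar>" by (meson abs_ge_self order_trans)
  ultimately show "ob_apply L x \<in> B" by (rule solid)
qed

section \<open>Adherences\<close>

text \<open>The common description of the two adherences, with filters on the operators themselves in place of
  nets.\<close>

definition orth_adherence :: "'a::dedekind_complete_vector_lattice ob_op set \<Rightarrow> 'a ob_op set" where
  "orth_adherence S = {L \<in> Orth. \<exists>F. F \<noteq> bot \<and> (\<forall>\<^sub>F T in F. T \<in> S) \<and> orth_null F (\<lambda>T. T - L)}"

lemma orth_null_filtermap: "orth_null (filtermap h F) A \<longleftrightarrow> orth_null F (\<lambda>i. A (h i))"
  unfolding orth_null_def order_null_filtermap ..

lemma orth_null_compose: "orth_null F A \<Longrightarrow> filterlim h F G \<Longrightarrow> orth_null G (\<lambda>i. A (h i))"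
  unfolding orth_null_def using order_null_compose by fast

lemma orth_adherenceI:
  assumes "L \<in> Orth" "F \<noteq> bot" "\<forall>\<^sub>F i in F. T i \<in> S" "orth_null F (\<lambda>i. T i - L)"
  shows "L \<in> orth_adherence S"
  unfolding orth_adherence_def using assms
  by (auto simp: orth_null_filtermap eventually_filtermap filtermap_bot_iff
      intro!: exI[of _ "filtermap T F"])

text \<open>The index set consists of the pairs of a point and a member of the filter containing it, ordered by
  reverse inclusion of the second components.\<close>

lemma filter_as_net:
  fixes F :: "'x filter"
  assumes F: "F \<noteq> bot" and S: "\<forall>\<^sub>F z in F. z \<in> S"
  obtains I :: "('x \<times> 'x set) set" and le
  where "directed_set I le" "fst ` I \<subseteq> S" "filterlim fst F (tail_filter I le)"
proof -
  define I where "I = {(z, X). z \<in> X \<and> z \<in> S \<and> (\<forall>\<^sub>F z in F. z \<in> X)}"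
  define le :: "'x \<times> 'x set \<Rightarrow> 'x \<times> 'x set \<Rightarrow> bool" where "le p q \<longleftrightarrow> snd q \<subseteq> snd p" for p q
  have ex: "\<exists>z. (z, X) \<in> I" if X: "\<forall>\<^sub>F z in F. z \<in> X" for X
    using eventually_happens'[OF F eventually_conj[OF X S]] X unfolding I_def by auto
  have dir: "directed_set I le"
    unfolding directed_set_def
  proof (intro conjI ballI impI)
    show "I \<noteq> {}" using ex[OF S] by blast
    fix p q assume p: "p \<in> I" and q: "q \<in> I"
    then have "\<forall>\<^sub>F z in F. z \<in> snd p \<inter> snd q" unfolding I_def by (auto intro: eventually_conj)
    then obtain z where "(z, snd p \<inter> snd q) \<in> I" using ex by blast
    then show "\<exists>r\<in>I. le p r \<and> le q r" unfolding le_def by (intro bexI) auto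
  qed (auto simp: le_def)
  show thesis
  proof (rule that[OF dir])
    show "fst ` I \<subseteq> S" unfolding I_def by auto
    show "filterlim fst F (tail_filter I le)"
      unfolding filterlim_iff
    proof (intro allI impI)
      fix P assume P: "eventually P F"
      then obtain z where z: "(z, Collect P) \<in> I" using ex[of "Collect P"] by auto
      show "\<forall>\<^sub>F p in tail_filter I le. P (fst p)"
        unfolding eventually_tail_filter[OF dir]
        by (rule bexI[OF _ z]) (auto simp: le_def I_def)
    qed
  qed
qed

lemma a_uo_eq_orth_adherence:
  assumes A: "A \<subseteq> Orth"
  shows "a_uo A = orth_adherence A"
proof (intro subset_antisym subsetI)
  fix L assume "L \<in> a_uo A"
  then obtain I :: "('a ob_op \<times> 'a ob_op set) set" and le T
    where dir: "directed_set I le" and T: "T ` I \<subseteq> A" and conv: "uo_converges I le T L"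
    unfolding a_uo_def by blast
  let ?F = "tail_filter I le"
  note F = tail_filter_neq_bot[OF dir]
  have TA: "\<forall>\<^sub>F i in ?F. T i \<in> A"
    unfolding eventually_tail_filter[OF dir] using dir T unfolding directed_set_def by blast
  have null: "\<And>R. 0 \<le> R \<Longrightarrow> order_null ?F (\<lambda>i. inf \<bar>T i - L\<bar> R)"
    using conv unfolding uo_converges_iff_order_null[OF dir] by blast
  have T_Orth: "\<forall>\<^sub>F i in ?F. T i \<in> Orth" using TA A by (auto elim: eventually_mono)
  have L: "L \<in> Orth" by (rule uo_limit_Orth[OF F T_Orth null]) simp
  have "orth_null ?F (\<lambda>i. T i - L)"
    using T_Orth
    by (intro uo_null_imp_orth_null null id_ob_op_nonneg)
      (auto elim!: eventually_mono intro: subspace_diff[OF subspace_Orth _ L])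
  with L F TA show "L \<in> orth_adherence A" by (rule orth_adherenceI)
next
  fix L assume "L \<in> orth_adherence A"
  then obtain F where L: "L \<in> Orth" and F: "F \<noteq> bot" "\<forall>\<^sub>F T in F. T \<in> A"
    and null: "orth_null F (\<lambda>T. T - L)"
    unfolding orth_adherence_def by blast
  obtain I :: "('a ob_op \<times> 'a ob_op set) set" and le
    where dir: "directed_set I le" and IA: "fst ` I \<subseteq> A" and lim: "filterlim fst F (tail_filter I le)"
    using filter_as_net[OF F] by blast
  have "\<forall>\<^sub>F T in F. T - L \<in> Orth"
    using F(2) A by (auto elim!: eventually_mono intro: subspace_diff[OF subspace_Orth _ L])
  from order_null_compose[OF orth_null_imp_uo_null[OF this null] lim]
  have "uo_converges I le fst L" unfolding uo_converges_iff_order_null[OF dir] by blast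
  with dir IA show "L \<in> a_uo A" unfolding a_uo_def by blast
qed

lemma a_SUO_eq_orth_adherence:
  assumes A: "A \<subseteq> Orth"
  shows "a_SUO A = orth_adherence A"
proof (intro subset_antisym subsetI)
  fix L assume "L \<in> a_SUO A"
  then obtain I :: "('a ob_op \<times> 'a ob_op set) set" and le T
    where dir: "directed_set I le" and T: "T ` I \<subseteq> A" and conv: "suo_converges I le T L"
    unfolding a_SUO_def by blast
  let ?F = "tail_filter I le"
  note F = tail_filter_neq_bot[OF dir]
  have TA: "\<forall>\<^sub>F i in ?F. T i \<in> A"
    unfolding eventually_tail_filter[OF dir] using dir T unfolding directed_set_def by blast
  have null: "\<And>x y. 0 \<le> y \<Longrightarrow> order_null ?F (\<lambda>i. inf \<bar>ob_apply (T i) x - ob_apply L x\<bar> y)"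
    using conv unfolding suo_converges_def uo_converges_iff_order_null[OF dir] by blast
  have T_Orth: "\<forall>\<^sub>F i in ?F. T i \<in> Orth" using TA A by (auto elim: eventually_mono)
  have L: "L \<in> Orth" by (rule suo_limit_Orth[OF F T_Orth null]) simp
  have "orth_null ?F (\<lambda>i. T i - L)" using null unfolding orth_null_def by simp
  with L F TA show "L \<in> orth_adherence A" by (rule orth_adherenceI)
next
  fix L assume "L \<in> orth_adherence A"
  then obtain F where L: "L \<in> Orth" and F: "F \<noteq> bot" "\<forall>\<^sub>F T in F. T \<in> A"
    and null: "orth_null F (\<lambda>T. T - L)"
    unfolding orth_adherence_def by blast
  obtain I :: "('a ob_op \<times> 'a ob_op set) set" and le
    where dir: "directed_set I le" and IA: "fst ` I \<subseteq> A" and lim: "filterlim fst F (tail_filter I le)"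
    using filter_as_net[OF F] by blast
  have "\<forall>\<^sub>F T in F. T - L \<in> Orth"
    using F(2) A by (auto elim!: eventually_mono intro: subspace_diff[OF subspace_Orth _ L])
  from order_null_compose[OF orth_null_imp_order_null[OF this null] lim]
  have "suo_converges I le fst L"
    unfolding suo_converges_def uo_converges_iff_order_null[OF dir] by simp
  with dir IA show "L \<in> a_SUO A" unfolding a_SUO_def by blast
qed

section \<open>Algebraic operations on adherences\<close>

text \<open>The approximating filters for \<open>L\<close> and \<open>M\<close> need not be related, so the operation is applied along their
  product.\<close>

lemma orth_adherence_binary:
  assumes L: "L \<in> orth_adherence A" and M: "M \<in> orth_adherence A"
    and closed: "\<And>S T. S \<in> A \<Longrightarrow> T \<in> A \<Longrightarrow> h S T \<in> A" and lim: "h L M \<in> Orth"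
    and cont: "\<And>F S T. \<forall>\<^sub>F p in F. S p \<in> A \<Longrightarrow> \<forall>\<^sub>F p in F. T p \<in> A \<Longrightarrow>
      orth_null F (\<lambda>p. S p - L) \<Longrightarrow> orth_null F (\<lambda>p. T p - M) \<Longrightarrow>
      orth_null (F :: ('a ob_op \<times> 'a ob_op) filter) (\<lambda>p. h (S p) (T p) - h L M)"
  shows "h L M \<in> orth_adherence (A :: 'a::dedekind_complete_vector_lattice ob_op set)"
proof -
  obtain F where F: "F \<noteq> bot" "\<forall>\<^sub>F T in F. T \<in> A" "orth_null F (\<lambda>T. T - L)"
    using L unfolding orth_adherence_def by blast
  obtain G where G: "G \<noteq> bot" "\<forall>\<^sub>F T in G. T \<in> A" "orth_null G (\<lambda>T. T - M)"
    using M unfolding orth_adherence_def by blast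
  have fst_lim: "filterlim fst F (F \<times>\<^sub>F G)" and snd_lim: "filterlim snd G (F \<times>\<^sub>F G)"
    unfolding filterlim_def by (rule filtermap_fst_prod_filter filtermap_snd_prod_filter)+
  have fst: "\<forall>\<^sub>F p in F \<times>\<^sub>F G. fst p \<in> A"
    by (rule eventually_compose_filterlim[OF F(2) fst_lim])
  have snd: "\<forall>\<^sub>F p in F \<times>\<^sub>F G. snd p \<in> A"
    by (rule eventually_compose_filterlim[OF G(2) snd_lim])
  show ?thesis
  proof (rule orth_adherenceI[OF lim])
    show "F \<times>\<^sub>F G \<noteq> bot" using F(1) G(1) by (simp add: prod_filter_eq_bot)
    show "\<forall>\<^sub>F p in F \<times>\<^sub>F G. h (fst p) (snd p) \<in> A"
      using fst snd by eventually_elim (rule closed)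
    show "orth_null (F \<times>\<^sub>F G) (\<lambda>p. h (fst p) (snd p) - h L M)"
      using fst snd orth_null_compose[OF F(3) fst_lim] orth_null_compose[OF G(3) snd_lim]
      by (rule cont)
  qed
qed

lemma orth_adherence_subset_Orth: "orth_adherence A \<subseteq> Orth"
  unfolding orth_adherence_def by blast

text \<open>Each term of \<open>S T - L M = (S - L) (T - M) + L (T - M) + (S - L) M\<close> is null: the first by the estimate of a
  product, the others because one factor is fixed.\<close>

lemma orth_null_mult_diff:
  fixes S T :: "'i \<Rightarrow> 'a::dedekind_complete_vector_lattice ob_op"
  assumes S: "\<forall>\<^sub>F i in F. S i \<in> Orth" and L: "L \<in> Orth"
    and SL: "orth_null F (\<lambda>i. S i - L)" and TM: "orth_null F (\<lambda>i. T i - M)"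
  shows "orth_null F (\<lambda>i. S i * T i - L * M)"
proof -
  have SL_Orth: "\<forall>\<^sub>F i in F. S i - L \<in> Orth"
    using S by eventually_elim (rule subspace_diff[OF subspace_Orth _ L])
  have "orth_null F (\<lambda>i. (S i - L) * (T i - M) + L * (T i - M))"
    by (rule orth_null_abs_le_sum[OF orth_null_mult[OF SL_Orth SL TM] orth_null_mult_left[OF L TM]])
      (simp add: abs_triangle_ineq del: ob_apply_simps(6))
  then have "orth_null F (\<lambda>i. ((S i - L) * (T i - M) + L * (T i - M)) + (S i - L) * M)"
    by (rule orth_null_abs_le_sum[OF _ orth_null_mult_right[OF SL_Orth SL, of M]])
      (simp add: abs_triangle_ineq del: ob_apply_simps(6))
  moreover have "((S i - L) * (T i - M) + L * (T i - M)) + (S i - L) * M = S i * T i - L * M" for i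
    by (simp add: algebra_simps)
  ultimately show ?thesis by simp
qed

lemma abs_sup_diff_le:
  fixes a b c d :: "'a::vector_lattice"
  shows "\<bar>sup a b - sup c d\<bar> \<le> \<bar>a - c\<bar> + \<bar>b - d\<bar>"
proof -
  have le: "sup a b - sup c d \<le> \<bar>a - c\<bar> + \<bar>b - d\<bar>" for a b c d :: 'a
  proof -
    have "a \<le> \<bar>a - c\<bar> + c" "b \<le> \<bar>b - d\<bar> + d"
      using abs_ge_self[of "a - c"] abs_ge_self[of "b - d"] by (simp_all only: diff_le_eq)
    moreover have "\<bar>a - c\<bar> + c \<le> \<bar>a - c\<bar> + \<bar>b - d\<bar> + sup c d"
      "\<bar>b - d\<bar> + d \<le> \<bar>a - c\<bar> + \<bar>b - d\<bar> + sup c d"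
      by (intro add_mono; simp)+
    ultimately have "sup a b \<le> \<bar>a - c\<bar> + \<bar>b - d\<bar> + sup c d" by (meson le_supI order_trans)
    then show ?thesis by (simp only: diff_le_eq)
  qed
  show ?thesis using le[of a b c d] le[of c d a b] by (simp add: abs_leI abs_minus_commute)
qed

lemma orth_null_sup_diff:
  fixes S T :: "'i \<Rightarrow> 'a::dedekind_complete_vector_lattice ob_op"
  assumes ST: "\<forall>\<^sub>F i in F. S i \<in> Orth" "\<forall>\<^sub>F i in F. T i \<in> Orth" and LM: "L \<in> Orth" "M \<in> Orth"
    and SL: "orth_null F (\<lambda>i. S i - L)" and TM: "orth_null F (\<lambda>i. T i - M)"
  shows "orth_null F (\<lambda>i. sup (S i) (T i) - sup L M)"
  using SL TM
proof (rule orth_null_abs_le_sum)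
  show "\<forall>\<^sub>F i in F. \<forall>x\<ge>0. \<bar>ob_apply (sup (S i) (T i) - sup L M) x\<bar>
      \<le> \<bar>ob_apply (S i - L) x\<bar> + \<bar>ob_apply (T i - M) x\<bar>"
    using ST
  proof eventually_elim
    case (elim i)
    then show ?case using LM by (simp add: ob_apply_sup_Orth abs_sup_diff_le)
  qed
qed

lemma subalgebra_orth_adherence:
  assumes A: "subalgebra_of_Orth A"
  shows "subalgebra_of_Orth (orth_adherence (A :: 'a::dedekind_complete_vector_lattice ob_op set))"
proof -
  have AO: "A \<subseteq> Orth" and sub: "subspace A" and mult: "\<And>S T. S \<in> A \<Longrightarrow> T \<in> A \<Longrightarrow> S * T \<in> A"
    using A unfolding subalgebra_of_Orth_def by blast+
  note O = subsetD[OF orth_adherence_subset_Orth]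
  have "0 \<in> orth_adherence A"
    using orth_null_const_0 subspace_0[OF sub] subspace_0[OF subspace_Orth]
    by (intro orth_adherenceI[of _ "principal {()}" "\<lambda>_. 0"])
      (auto simp: eventually_principal principal_eq_bot_iff)
  moreover have "L + M \<in> orth_adherence A" if LM: "L \<in> orth_adherence A" "M \<in> orth_adherence A" for L M
  proof (rule orth_adherence_binary[OF LM])
    fix F :: "('a ob_op \<times> 'a ob_op) filter" and S T
    assume "orth_null F (\<lambda>p. S p - L)" "orth_null F (\<lambda>p. T p - M)"
    then show "orth_null F (\<lambda>p. S p + T p - (L + M))"
    proof (rule orth_null_abs_le_sum)
      have "\<bar>ob_apply (S p + T p - (L + M)) x\<bar> \<le> \<bar>ob_apply (S p - L) x\<bar> + \<bar>ob_apply (T p - M) x\<bar>" for p x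
        using abs_diff_triangle_ineq[of "ob_apply (S p) x" "ob_apply (T p) x"] by simp
      then show "\<forall>\<^sub>F p in F. \<forall>x\<ge>0. \<bar>ob_apply (S p + T p - (L + M)) x\<bar>
          \<le> \<bar>ob_apply (S p - L) x\<bar> + \<bar>ob_apply (T p - M) x\<bar>" by simp
    qed
  qed (use O LM subspace_add[OF sub] subspace_add[OF subspace_Orth] in blast)+
  moreover have "L * M \<in> orth_adherence A" if LM: "L \<in> orth_adherence A" "M \<in> orth_adherence A" for L M
  proof (rule orth_adherence_binary[OF LM])
    fix F :: "('a ob_op \<times> 'a ob_op) filter" and S T
    assume "\<forall>\<^sub>F p in F. S p \<in> A"
    then have "\<forall>\<^sub>F p in F. S p \<in> Orth" using AO by (auto elim: eventually_mono)
    moreover assume "orth_null F (\<lambda>p. S p - L)" "orth_null F (\<lambda>p. T p - M)"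
    ultimately show "orth_null F (\<lambda>p. S p * T p - L * M)" using O[OF LM(1)] orth_null_mult_diff by blast
  qed (use O LM mult Orth_mult in blast)+
  moreover have "r *\<^sub>R L \<in> orth_adherence A" if L: "L \<in> orth_adherence A" for r L
  proof (rule orth_adherence_binary[OF L L, of "\<lambda>S T. r *\<^sub>R S"])
    fix F :: "('a ob_op \<times> 'a ob_op) filter" and S
    assume null: "orth_null F (\<lambda>p. S p - L)"
    have "orth_null F (\<lambda>p. (r *\<^sub>R id_ob_op) * (S p - L))"
      using subspace_scale[OF subspace_Orth Orth_id] null by (rule orth_null_mult_left)
    moreover have "(r *\<^sub>R id_ob_op) * (S p - L) = r *\<^sub>R S p - r *\<^sub>R L" for p
      by transfer (simp add: scaleR_diff_right fun_eq_iff)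
    ultimately show "orth_null F (\<lambda>p. r *\<^sub>R S p - r *\<^sub>R L)" by simp
  qed (use O L subspace_scale[OF sub] subspace_scale[OF subspace_Orth] in blast)+
  ultimately show ?thesis
    unfolding subalgebra_of_Orth_def subspace_def using orth_adherence_subset_Orth by blast
qed

lemma vector_lattice_subalgebra_orth_adherence:
  assumes A: "vector_lattice_subalgebra_of_Orth A"
  shows "vector_lattice_subalgebra_of_Orth (orth_adherence (A :: 'a::dedekind_complete_vector_lattice ob_op set))"
proof -
  have alg: "subalgebra_of_Orth (orth_adherence A)"
    using A subalgebra_orth_adherence unfolding vector_lattice_subalgebra_of_Orth_def by blast
  have AO: "A \<subseteq> Orth" and sup_A: "\<And>S T. S \<in> A \<Longrightarrow> T \<in> A \<Longrightarrow> sup S T \<in> A"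
    using A unfolding vector_lattice_subalgebra_of_Orth_def subalgebra_of_Orth_def vector_sublattice_def
    by blast+
  note O = subsetD[OF orth_adherence_subset_Orth]
  have sub: "subspace (orth_adherence A)" using alg unfolding subalgebra_of_Orth_def by blast
  have sup: "sup L M \<in> orth_adherence A" if LM: "L \<in> orth_adherence A" "M \<in> orth_adherence A" for L M
  proof (rule orth_adherence_binary[OF LM])
    fix F :: "('a ob_op \<times> 'a ob_op) filter" and S T
    assume "\<forall>\<^sub>F p in F. S p \<in> A" "\<forall>\<^sub>F p in F. T p \<in> A"
    then have "\<forall>\<^sub>F p in F. S p \<in> Orth" "\<forall>\<^sub>F p in F. T p \<in> Orth"
      using AO by (auto elim: eventually_mono)
    moreover assume "orth_null F (\<lambda>p. S p - L)" "orth_null F (\<lambda>p. T p - M)"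
    ultimately show "orth_null F (\<lambda>p. sup (S p) (T p) - sup L M)"
      using O[OF LM(1)] O[OF LM(2)] by (intro orth_null_sup_diff)
  qed (use O LM sup_A Orth_sup in blast)+
  have "inf L M \<in> orth_adherence A" if LM: "L \<in> orth_adherence A" "M \<in> orth_adherence A" for L M
  proof -
    have "inf L M = L + M - sup L M" using add_eq_inf_sup[of L M] by simp
    then show ?thesis using LM sup[OF LM] sub by (simp add: subspace_add subspace_diff)
  qed
  with alg sub sup show ?thesis
    unfolding vector_lattice_subalgebra_of_Orth_def vector_sublattice_def by blast
qed

theorem corollary5p9:
  fixes \<A> :: "'a::dedekind_complete_vector_lattice ob_op set"
  assumes "subalgebra_of_Orth \<A>"
  shows "a_uo \<A> = a_SUO \<A> \<and>
    subalgebra_of_Orth (a_uo \<A>) \<and> subalgebra_of_Orth (a_SUO \<A>) \<and>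
    (vector_lattice_subalgebra_of_Orth \<A> \<longrightarrow> vector_lattice_subalgebra_of_Orth (a_uo \<A>))"
proof -
  have "\<A> \<subseteq> Orth" using assms unfolding subalgebra_of_Orth_def by blast
  then have "a_uo \<A> = orth_adherence \<A>" "a_SUO \<A> = orth_adherence \<A>"
    by (rule a_uo_eq_orth_adherence a_SUO_eq_orth_adherence)+
  then show ?thesis
    using subalgebra_orth_adherence[OF assms] vector_lattice_subalgebra_orth_adherence[of \<A>] by simp
qed

end
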